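(* Let $n$ be a nonnegative integer. Then (i) $Q_2(n) = c(n)-d(n-2)$; (ii) $b_6(n) = c(n)+d(n-2)$.
   Context: A partition is called $6$-regular if none of its parts is divisible by $6$; $b_6(n)$ denotes the number of $6$-regular partitions of $n$. $Q_2(n)$ denotes the number of partitions of $n$ into distinct parts which are not congruent to $\pm 2$ modulo $6$. $c(n)$ denotes the number of partitions of $n$ into parts which are not congruent to $0,\pm 2,\pm 20,\pm 22,24$ modulo $48$. $d(n)$ denotes the number of partitions of $n$ into parts which are not congruent to $0,\pm 4,\pm 10,\pm 14,24$ modulo $48$. All these functions equal $1$ at $n=0$, and $d(n)=0$ for $n<0$. *)

theory Defs
  imports "HOL-Library.Multiset" "HOL-Number_Theory.Cong"
begin

definition partitions :: "nat \<Rightarrow> nat multiset set" where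
  "partitions n = {M. (\<forall>k\<in>#M. 0 < k) \<and> \<Sum>\<^sub># M = n}"

definition partitions_avoiding :: "int \<Rightarrow> int set \<Rightarrow> nat \<Rightarrow> nat multiset set" where
  "partitions_avoiding m R n =
     {M \<in> partitions n. \<forall>k\<in>#M. \<forall>r\<in>R. \<not> [int k = r] (mod m)}"

definition b6 :: "nat \<Rightarrow> nat" where
  "b6 n = card {M \<in> partitions n. \<forall>k\<in>#M. \<not> 6 dvd k}"

definition Q2 :: "nat \<Rightarrow> nat" where
  "Q2 n = card {M \<in> partitions_avoiding 6 {2, -2} n. \<forall>k\<in>#M. count M k = 1}"

definition c :: "nat \<Rightarrow> nat" where
  "c n = card (partitions_avoiding 48 {0, 2, -2, 20, -20, 22, -22, 24} n)"

text \<open>The argument is an integer because \<open>d\<close> is evaluated at \<open>n - 2\<close>, which must not be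
  truncated when \<open>n < 2\<close>.\<close>

definition d :: "int \<Rightarrow> nat" where
  "d n = (if n < 0 then 0
          else card (partitions_avoiding 48 {0, 4, -4, 10, -10, 14, -14, 24} (nat n)))"

text \<open>All cardinalities above are those of finite sets.\<close>

lemma finite_partitions: "finite (partitions n)"
proof (rule finite_subset)
  show "partitions n \<subseteq> mset ` {xs. set xs \<subseteq> {..n} \<and> length xs \<le> n}"
  proof
    fix M assume M: "M \<in> partitions n"
    obtain xs where xs: "M = mset xs" by (metis ex_mset)
    have pos: "\<forall>k\<in>set xs. 0 < k" and sum: "sum_list xs = n"
      using M by (auto simp: partitions_def xs sum_mset_sum_list)
    have "length xs \<le> sum_list xs"
      using pos by (induction xs) fastforce+
    then show "M \<in> mset ` {xs. set xs \<subseteq> {..n} \<and> length xs \<le> n}"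
      using xs sum member_le_sum_list by fastforce
  qed
  show "finite (mset ` {xs. set xs \<subseteq> {..n} \<and> length xs \<le> n})"
    by (intro finite_imageI finite_lists_length_le) simp
qed

lemma partitions_0: "partitions 0 = {{#}}"
  by (auto simp: partitions_def intro!: multiset_eqI) (metis less_numeral_extra(3) not_in_iff)

lemma values_at_0: "b6 0 = 1" "Q2 0 = 1" "c 0 = 1" "d 0 = 1"
proof -
  have *: "{M. M = {#} \<and> P M} = {{#}}" if "P {#}" for P :: "nat multiset \<Rightarrow> bool"
    using that by auto
  show "b6 0 = 1" "Q2 0 = 1" "c 0 = 1" "d 0 = 1"
    by (simp_all add: b6_def Q2_def c_def d_def partitions_avoiding_def partitions_0 *)
qed

end

theory Submission
  imports Defs "HOL-Analysis.Analysis"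
begin

text \<open>
  Write $f_m$ for the product of all $1 - x^{mk}$, $k > 0$. Multiplying the four generating functions by $f_1$
  leaves products over residue classes. The ones belonging to $c$ and $d$ are quintuple products, hence
  differences of theta series: $f_1 C = u - v$ and $x^2 f_1 D = v - w$ with the same $v$.
  By the Jacobi triple product $f_1 B_6 = f_6 = u - w$ and, specialising to a cube root of unity,
  $f_1 Q_2 = u + w - 2 v$. So both claims hold between power series on $0 < x < 1$, and
  coefficients can be compared.
\<close>

section \<open>The Jacobi triple product\<close>

text \<open>The common series \<open>v\<close> has an arithmetic origin. A quintuple product with
  \<open>q = x ^ m\<close> and \<open>z = x ^ a\<close> yields theta series in base
  \<open>x ^ (3 * m)\<close> with arguments \<open>x ^ (3 * a + m)\<close> and
  \<open>x ^ (3 * a + 2 * m)\<close>, the second with factor \<open>x ^ a\<close>. For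
  \<open>m = 24\<close>, the values \<open>a = 2\<close> and \<open>a = 10\<close> give the
  exponents 30, 54 and 54, 78: they overlap because the two values differ by m / 3 = 8, and the
  factor \<open>x ^ 2\<close> of the common series is the shift in \<open>d (n - 2)\<close>. The
  series for \<open>b6\<close> and \<open>Q2\<close> arise in base \<open>x ^ 18\<close>; splitting
  by the parity of the index raises the base to its fourth power, again \<open>x ^ 72\<close>. The
  cube root of unity forces complex arguments, so theta series are treated over any complete normed
  field and taken back to the reals afterwards.\<close>

definition tri :: "int \<Rightarrow> int" where "tri k = k * (k - 1) div 2"

lemma two_tri: "2 * tri k = k * (k - 1)"
  unfolding tri_def by (rule dvd_mult_div_cancel) simp

text \<open>The quadratic function \<open>tri\<close> is additive up to a bilinear term; this is
  what turns index shifts into powers of \<open>q\<close>.\<close>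

lemma tri_add: "tri (a + b) = tri a + tri b + a * b"
proof -
  have "2 * tri (a + b) = 2 * (tri a + tri b + a * b)"
    unfolding distrib_left[of 2] two_tri by (simp add: algebra_simps)
  then show ?thesis by simp
qed

lemma tri_0 [simp]: "tri 0 = 0" and tri_1 [simp]: "tri 1 = 0"
  by (simp_all add: tri_def)

lemma tri_neg: "tri (- k) = tri k + k"
  using two_tri[of k] two_tri[of "-k"] by (simp add: algebra_simps)

text \<open>The q-Pochhammer symbol (q; q)_n.\<close>

definition qfact :: "'a::comm_ring_1 \<Rightarrow> nat \<Rightarrow> 'a" where
  "qfact q n = (\<Prod>i<n. 1 - q ^ Suc i)"

text \<open>The Gaussian binomial coefficient. The value 0 for \<open>k > n\<close> makes the Pascal
  rule hold at \<open>k = n\<close> and lets sums run one index too far.\<close>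

definition qbinom :: "'a::field \<Rightarrow> nat \<Rightarrow> nat \<Rightarrow> 'a" where
  "qbinom q n k = (if k \<le> n then qfact q n / (qfact q k * qfact q (n - k)) else 0)"

lemma qfact_Suc: "qfact q (Suc n) = qfact q n * (1 - q ^ Suc n)"
  by (simp add: qfact_def)

lemma qfact_0 [simp]: "qfact q 0 = 1"
  by (simp add: qfact_def)

lemma qbinom_Suc_Suc:
  fixes q :: "'a::field"
  assumes "\<And>n. qfact q n \<noteq> 0" "k \<le> n"
  shows "qbinom q (Suc n) (Suc k) = qbinom q n (Suc k) + q ^ (n - k) * qbinom q n k"
proof (cases "k = n")
  case True
  then show ?thesis using assms(1)[of n] assms(1)[of "Suc n"] by (simp add: qbinom_def)
next
  case False
  then obtain m where n: "n = Suc (k + m)"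
    using assms(2) by (metis less_imp_Suc_add order_le_neq_trans)
  have nz: "qfact q k \<noteq> 0" "qfact q m \<noteq> 0" "1 - q ^ Suc k \<noteq> 0" "1 - q ^ Suc m \<noteq> 0"
    using assms(1)[of "Suc k"] assms(1)[of "Suc m"] by (auto simp: qfact_Suc)
  \<comment> \<open>Since Suc n = Suc m + Suc k, the numerator splits so that each summand cancels
    one factor of the denominator; these are the two Pascal terms.\<close>
  have e: "1 - q ^ Suc n = (1 - q ^ Suc m) + q ^ Suc m * (1 - q ^ Suc k)"
    by (simp add: n algebra_simps power_add)
  have "qbinom q (Suc n) (Suc k) =
      qfact q n * (1 - q ^ Suc n) / (qfact q k * (1 - q ^ Suc k) * (qfact q m * (1 - q ^ Suc m)))"
    by (simp add: n qbinom_def qfact_Suc[of q "Suc (k + m)"] qfact_Suc[of q k] qfact_Suc[of q m]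
        del: power_Suc)
  also have "\<dots> = qfact q n / (qfact q k * (1 - q ^ Suc k) * qfact q m)
      + q ^ Suc m * (qfact q n / (qfact q k * (qfact q m * (1 - q ^ Suc m))))"
    unfolding e using nz by (simp add: divide_simps del: power_Suc) (simp add: algebra_simps del: power_Suc)
  also have "\<dots> = qbinom q n (Suc k) + q ^ (n - k) * qbinom q n k"
    by (simp add: n qbinom_def qfact_Suc[of q k] qfact_Suc[of q m] Suc_diff_le del: power_Suc)
  finally show ?thesis .
qed

text \<open>Induction appends the factor \<open>1 + y * q ^ n\<close>. The Pascal weight
  \<open>q ^ (n - j)\<close> and the ratio \<open>q ^ j * y\<close> of consecutive terms combine to
  \<open>y * q ^ n\<close>, independent of \<open>j\<close>.\<close>

lemma q_binomial_theorem:
  fixes q y :: "'a::field"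
  assumes q: "q \<noteq> 0" and nz: "\<And>n. qfact q n \<noteq> 0"
  shows "(\<Prod>i<n. 1 + y * q ^ i) = (\<Sum>j\<le>n. qbinom q n j * (q powi tri (int j) * y ^ j))"
proof (induction n)
  case 0
  show ?case by (simp add: qbinom_def)
next
  case (Suc n)
  define t where "t j = q powi tri (int j) * y ^ j" for j
  have t_Suc: "t (Suc j) = q ^ j * y * t j" for j
    using q tri_add[of "int j" 1] by (simp add: t_def power_int_add add.commute)
  have [simp]: "qbinom q m 0 = 1" for m
    using nz[of m] by (simp add: qbinom_def)
  have "(\<Sum>j\<le>Suc n. qbinom q (Suc n) j * t j)
      = t 0 + (\<Sum>j\<le>n. qbinom q (Suc n) (Suc j) * t (Suc j))"
    by (subst sum.atMost_Suc_shift) simp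
  also have "(\<Sum>j\<le>n. qbinom q (Suc n) (Suc j) * t (Suc j)) =
      (\<Sum>j\<le>n. qbinom q n (Suc j) * t (Suc j)) + (\<Sum>j\<le>n. q ^ (n - j) * qbinom q n j * t (Suc j))"
    by (simp add: qbinom_Suc_Suc[OF nz] distrib_right sum.distrib)
  also have "(\<Sum>j\<le>n. q ^ (n - j) * qbinom q n j * t (Suc j)) = (\<Sum>j\<le>n. qbinom q n j * t j) * (y * q ^ n)"
    unfolding sum_distrib_right
  proof (rule sum.cong[OF refl])
    fix j assume "j \<in> {..n}"
    then have "q ^ n = q ^ (n - j) * q ^ j" by (simp flip: power_add)
    then show "q ^ (n - j) * qbinom q n j * t (Suc j) = qbinom q n j * t j * (y * q ^ n)"
      by (simp add: t_Suc)
  qed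
  also have "t 0 + ((\<Sum>j\<le>n. qbinom q n (Suc j) * t (Suc j)) + (\<Sum>j\<le>n. qbinom q n j * t j) * (y * q ^ n))
     = (\<Sum>j\<le>Suc n. qbinom q n j * t j) + (\<Sum>j\<le>n. qbinom q n j * t j) * (y * q ^ n)"
    by (subst sum.atMost_Suc_shift) simp
  also have "(\<Sum>j\<le>Suc n. qbinom q n j * t j) = (\<Sum>j\<le>n. qbinom q n j * t j)"
    by (simp add: qbinom_def)
  finally show ?case
    using Suc.IH by (simp add: t_def distrib_left)
qed

text \<open>The q-binomial theorem with 2 * n factors and \<open>y = z / q ^ n\<close>: the upper
  half of the factors is \<open>1 + z * q ^ i\<close>, and pulling \<open>z / q ^ Suc i\<close> out
  of the lower half leaves \<open>1 + q ^ Suc i / z\<close>.\<close>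

lemma finite_jacobi_triple_product:
  fixes q z :: "'a::field"
  assumes q: "q \<noteq> 0" and z: "z \<noteq> 0" and nz: "\<And>n. qfact q n \<noteq> 0"
  shows "(\<Prod>i<n. (1 + z * q ^ i) * (1 + q ^ Suc i / z)) =
    (\<Sum>k\<in>{- int n..int n}. qbinom q (2 * n) (nat (int n + k)) * (z powi k * q powi tri k))"
proof -
  define y where "y = z / q ^ n"
  \<comment> \<open>The product of the monomials pulled out of the lower half.\<close>
  define w where "w = (\<Prod>i<n. z / q ^ Suc i)"
  have w: "w = z powi int n * q powi (- tri (int n + 1))"
  proof (unfold w_def, induction n)
    case (Suc n)
    have "int (Suc n) + 1 = (int n + 1) + 1" by simp
    then have "tri (int (Suc n) + 1) = tri (int n + 1) + (int n + 1)"
      using tri_add[of "int n + 1" 1] by simp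
    then have "q powi (- tri (int (Suc n) + 1)) = q powi (- tri (int n + 1)) / q ^ Suc n"
    proof -
      have "- tri (int (Suc n) + 1) = - tri (int n + 1) - int (Suc n)"
        using \<open>tri (int (Suc n) + 1) = tri (int n + 1) + (int n + 1)\<close> by simp
      then show ?thesis
        using q by (simp only: power_int_diff power_int_of_nat simp_thms)
    qed
    moreover have "z powi int (Suc n) = z powi int n * z"
      unfolding power_int_of_nat by simp
    ultimately show ?case
      using Suc by simp
  qed simp
  have w0: "w \<noteq> 0" using q z by (simp add: w_def)
  have "(\<Prod>i<2*n. 1 + y * q ^ i) = (\<Prod>i<n. 1 + y * q ^ i) * (\<Prod>i=n..<2*n. 1 + y * q ^ i)"
    by (metis lessThan_atLeast0 prod.atLeastLessThan_concat mult_2 le_add1 zero_le)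
  also have "(\<Prod>i=n..<2*n. 1 + y * q ^ i) = (\<Prod>i<n. 1 + z * q ^ i)"
    using prod.shift_bounds_nat_ivl[of "\<lambda>i. 1 + y * q ^ i" 0 n n] q
    by (simp add: y_def power_add lessThan_atLeast0 mult_2)
  also have "(\<Prod>i<n. 1 + y * q ^ i) = (\<Prod>i<n. 1 + y * q ^ (n - Suc i))"
    by (rule prod.nat_diff_reindex[symmetric])
  also have "\<dots> = (\<Prod>i<n. z / q ^ Suc i * (1 + q ^ Suc i / z))"
  proof (rule prod.cong[OF refl])
    fix i assume "i \<in> {..<n}"
    then have "q ^ n = q ^ (n - Suc i) * q ^ Suc i" by (simp del: power_Suc flip: power_add)
    then have "y * q ^ (n - Suc i) = z / q ^ Suc i"
      using q by (simp add: y_def)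
    moreover have "z / q ^ Suc i * (1 + q ^ Suc i / z) = z / q ^ Suc i + 1"
      using z q by (simp add: distrib_left)
    ultimately show "1 + y * q ^ (n - Suc i) = z / q ^ Suc i * (1 + q ^ Suc i / z)"
      by simp
  qed
  also have "\<dots> = w * (\<Prod>i<n. 1 + q ^ Suc i / z)"
    by (simp only: prod.distrib w_def)
  finally have "w * (\<Prod>i<n. (1 + z * q ^ i) * (1 + q ^ Suc i / z)) = (\<Prod>i<2*n. 1 + y * q ^ i)"
    by (simp add: prod.distrib mult_ac)
  also have "\<dots> = (\<Sum>j\<le>2*n. qbinom q (2*n) j * (q powi tri (int j) * y ^ j))"
    by (rule q_binomial_theorem[OF q nz])
  \<comment> \<open>The index is recentred at n:
    \<open>tri (n + k) - n * (n + k) = tri k - tri (n + 1)\<close>, and the part free of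
    \<open>k\<close> is exactly the power of \<open>q\<close> in \<open>w\<close>.\<close>
  also have "\<dots> = (\<Sum>k\<in>{- int n..int n}. w * (qbinom q (2 * n) (nat (int n + k)) * (z powi k * q powi tri k)))"
  proof (rule sum.reindex_bij_witness[of _ "\<lambda>k. nat (int n + k)" "\<lambda>j. int j - int n"])
    fix j assume "j \<in> {..2*n}"
    define k where "k = int j - int n"
    have j: "int j = int n + k" by (simp add: k_def)
    have "y ^ j = z powi (int n + k) * q powi (- (int n * (int n + k)))"
      unfolding j[symmetric] y_def power_int_minus of_nat_mult[symmetric] power_int_of_nat
      by (simp add: divide_inverse power_mult_distrib power_inverse power_mult)
    moreover have "tri (int n + k) - int n * (int n + k) = - tri (int n + 1) + tri k"
      using tri_add[of "int n" k] tri_add[of "int n" 1] two_tri[of "int n"] by (simp add: algebra_simps)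
    then have "q powi tri (int n + k) * q powi (- (int n * (int n + k))) = q powi (- tri (int n + 1)) * q powi tri k"
      using q by (simp add: power_int_add[symmetric])
    moreover have "z powi (int n + k) = z powi int n * z powi k"
      using z by (simp add: power_int_add)
    ultimately have "q powi tri (int j) * y ^ j = w * (z powi k * q powi tri k)"
      unfolding w j by (simp add: mult_ac)
    then show "w * (qbinom q (2*n) (nat (int n + (int j - int n))) * (z powi (int j - int n) * q powi tri (int j - int n)))
        = qbinom q (2*n) j * (q powi tri (int j) * y ^ j)"
      by (simp add: k_def)
  qed auto
  finally have "w * (\<Prod>i<n. (1 + z * q ^ i) * (1 + q ^ Suc i / z)) =
    w * (\<Sum>k\<in>{- int n..int n}. qbinom q (2 * n) (nat (int n + k)) * (z powi k * q powi tri k))"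
    by (simp only: sum_distrib_left)
  then show ?thesis
    using w0 by simp
qed

section \<open>Convergence of theta series and q-products\<close>

lemma summable_power_tri:
  fixes w r :: real
  assumes "0 \<le> w" "0 < r" "r < 1"
  shows "summable (\<lambda>n. w ^ n * r powi tri (int n))"
proof -
  \<comment> \<open>The ratio of consecutive terms is \<open>w * r ^ n\<close>, which tends to 0
    however large \<open>w\<close> is.\<close>
  have step: "w ^ Suc n * r powi tri (int (Suc n)) = w * r ^ n * (w ^ n * r powi tri (int n))" for n
    using tri_add[of "int n" 1] assms by (simp add: power_int_add add.commute)
  have "(\<lambda>n. w * r ^ n) \<longlonglongrightarrow> w * 0"
    using assms by (intro tendsto_intros LIMSEQ_realpow_zero) auto
  then have "\<forall>\<^sub>F n in sequentially. w * r ^ n < 1 / 2"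
    by (rule order_tendstoD) simp
  then obtain N where N: "\<And>n. n \<ge> N \<Longrightarrow> w * r ^ n < 1 / 2"
    by (auto simp: eventually_sequentially)
  show ?thesis
  proof (rule summable_ratio_test[where c = "1/2" and N = N])
    fix n assume "N \<le> n"
    have "0 \<le> w ^ n * r powi tri (int n)" using assms by simp
    then have "w * r ^ n * (w ^ n * r powi tri (int n)) \<le> 1 / 2 * (w ^ n * r powi tri (int n))"
      using N[OF \<open>N \<le> n\<close>] by (intro mult_right_mono) auto
    then show "norm (w ^ Suc n * r powi tri (int (Suc n))) \<le> 1 / 2 * norm (w ^ n * r powi tri (int n))"
      unfolding step using assms by (simp add: abs_mult)
  qed simp
qed

text \<open>The negative half of the series has the form of the positive half, with
  \<open>norm q / norm z\<close> in place of \<open>norm z\<close>. The halves overlap at 0, which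
  does no harm to summability.\<close>

lemma abs_summable_theta:
  fixes q z :: "'a::real_normed_field"
  assumes q: "q \<noteq> 0" "norm q < 1" and z: "z \<noteq> 0"
  shows "(\<lambda>k. z powi k * q powi tri k) abs_summable_on (UNIV :: int set)"
proof -
  define f where "f k = norm z powi k * norm q powi tri k" for k
  have f0: "f k \<ge> 0" for k by (simp add: f_def)
  have "summable (\<lambda>n. f (int n))"
    unfolding f_def using summable_power_tri[of "norm z" "norm q"] q by simp
  then have "(f \<circ> int) summable_on UNIV"
    using f0 by (intro summable_nonneg_imp_summable_on) (auto simp: o_def)
  then have 1: "f summable_on range int"
    by (subst summable_on_reindex) auto
  have eq: "f (- int n) = (norm q / norm z) ^ n * norm q powi tri (int n)" for n
  proof -
    have "norm q powi tri (- int n) = norm q powi tri (int n) * norm q ^ n"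
      using q by (simp add: tri_neg power_int_add)
    then show ?thesis
      by (simp add: f_def power_int_minus divide_inverse power_mult_distrib power_inverse)
  qed
  have "summable (\<lambda>n. f (- int n))"
    unfolding eq using summable_power_tri[of "norm q / norm z" "norm q"] q by simp
  then have "(f \<circ> (\<lambda>n. - int n)) summable_on UNIV"
    using f0 by (intro summable_nonneg_imp_summable_on) (auto simp: o_def)
  then have 2: "f summable_on range (\<lambda>n. - int n)"
    by (subst summable_on_reindex) (auto intro: injI)
  have "k \<in> range int \<union> range (\<lambda>n. - int n)" for k
    by (cases k rule: int_cases2) auto
  then have "range int \<union> range (\<lambda>n. - int n) = UNIV"
    by blast
  then have "f summable_on UNIV"
    using summable_on_union[OF 1 2] by simp
  then show ?thesis
    by (simp add: f_def[abs_def] norm_mult norm_power_int)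
qed


lemma convergent_prod_one_minus_power:
  fixes q :: "'a::{real_normed_field,banach}"
  assumes "norm q < 1"
  shows "convergent_prod (\<lambda>i. 1 - q ^ Suc i)"
proof (rule abs_convergent_prod_imp_convergent_prod, unfold abs_convergent_prod_conv_summable)
  have "summable (\<lambda>i. norm q ^ Suc i)"
    unfolding summable_Suc_iff using assms by (simp add: summable_geometric)
  then show "summable (\<lambda>i. norm (1 - q ^ Suc i - 1))"
    by (simp add: norm_power norm_mult)
qed

lemma one_minus_power_nonzero:
  fixes q :: "'a::real_normed_field"
  assumes "norm q < 1"
  shows "1 - q ^ Suc i \<noteq> 0"
proof
  assume "1 - q ^ Suc i = 0"
  then have "norm (q ^ Suc i) = 1" by simp
  moreover have "norm q ^ Suc i \<le> norm q ^ 1"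
    using assms by (intro power_decreasing) auto
  ultimately show False
    using assms by (simp only: norm_power power_one_right)
qed

lemma qfact_nonzero:
  fixes q :: "'a::real_normed_field"
  assumes "norm q < 1"
  shows "qfact q n \<noteq> 0"
  unfolding qfact_def prod_zero_iff[OF finite_lessThan]
  using one_minus_power_nonzero[OF assms] by blast

text \<open>The limit must be nonzero because the coefficients of the finite triple product carry
  \<open>qfact\<close> in the denominator.\<close>

lemma qfact_tendsto:
  fixes q :: "'a::{real_normed_field,banach}"
  assumes "norm q < 1"
  obtains L where "qfact q \<longlonglongrightarrow> L" "L \<noteq> 0"
proof
  have c: "convergent_prod (\<lambda>i. 1 - q ^ Suc i)"
    by (rule convergent_prod_one_minus_power[OF assms])
  show "prodinf (\<lambda>i. 1 - q ^ Suc i) \<noteq> 0"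
    by (rule prodinf_nonzero[OF c one_minus_power_nonzero[OF assms]])
  have "(\<lambda>n. qfact q (Suc n)) \<longlonglongrightarrow> prodinf (\<lambda>i. 1 - q ^ Suc i)"
    using convergent_prod_LIMSEQ[OF c] by (simp only: qfact_def lessThan_Suc_atMost)
  then show "qfact q \<longlonglongrightarrow> prodinf (\<lambda>i. 1 - q ^ Suc i)"
    by (rule LIMSEQ_imp_Suc)
qed

text \<open>Tannery's theorem for bilateral series: \<open>int_decode\<close> enumerates the
  integers, and domination makes the order of summation irrelevant.\<close>

lemma tendsto_infsum_dominated:
  fixes f :: "int \<Rightarrow> nat \<Rightarrow> 'a::{real_normed_field,banach}"
  assumes lim: "\<And>k. f k \<longlonglongrightarrow> g k"
    and bound: "\<And>k n. norm (f k n) \<le> M k"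
    and M: "M summable_on UNIV"
  shows "(\<lambda>n. infsum (\<lambda>k. f k n) UNIV) \<longlonglongrightarrow> infsum g UNIV"
proof -
  have "(\<lambda>i. M (int_decode i)) summable_on UNIV"
    using M summable_on_reindex_bij_betw[OF bij_int_decode, of M] by simp
  then have sM: "summable (\<lambda>i. M (int_decode i))"
    by (rule summable_on_imp_summable)
  have conv: "infsum h UNIV = (\<Sum>i. h (int_decode i))"
    if "\<And>k. norm (h k) \<le> M k" for h :: "int \<Rightarrow> 'a"
  proof -
    have "summable (\<lambda>i. norm (h (int_decode i)))"
      by (rule summable_comparison_test'[OF sM]) (use that in auto)
    then have "((\<lambda>i. h (int_decode i)) has_sum (\<Sum>i. h (int_decode i))) UNIV"
      using summable_sums[OF summable_norm_cancel] by (intro norm_summable_imp_has_sum) auto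
    then show ?thesis
      using has_sum_reindex_bij_betw[OF bij_int_decode, of h] by (simp add: infsumI)
  qed
  have "norm (g k) \<le> M k" for k
    by (rule tendsto_upperbound[OF tendsto_norm[OF lim]]) (auto simp: bound)
  moreover have "(\<lambda>n. \<Sum>i. f (int_decode i) n) \<longlonglongrightarrow> (\<Sum>i. g (int_decode i))"
    using tannerys_theorem[of "\<lambda>i n. f (int_decode i) n" "\<lambda>i. g (int_decode i)" sequentially "\<lambda>i. M (int_decode i)"]
      lim bound sM by (auto simp: case_prod_unfold)
  ultimately show ?thesis
    using bound by (simp add: conv)
qed

text \<open>The field is left general because the argument is real in the product formulas and a
  complex cube root of unity for \<open>Q2\<close>. In this normalisation the zeros in
  \<open>z\<close> are the negatives of the integer powers of \<open>q\<close>.\<close>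

definition theta :: "'a::{real_normed_field,banach} \<Rightarrow> 'a \<Rightarrow> 'a" where
  "theta q z = (\<Sum>\<^sub>\<infinity>k. z powi k * q powi tri k)"

text \<open>The form as a limit of partial products allows factors to be regrouped at a finite stage
  and single factors to vanish.\<close>

theorem jacobi_triple_product:
  fixes q z :: "'a::{real_normed_field,banach}"
  assumes q: "q \<noteq> 0" "norm q < 1" and z: "z \<noteq> 0"
  shows "(\<lambda>n. \<Prod>i<n. (1 - q ^ Suc i) * (1 + z * q ^ i) * (1 + q ^ Suc i / z))
    \<longlonglongrightarrow> theta q z"
proof -
  obtain L where L: "qfact q \<longlonglongrightarrow> L" "L \<noteq> 0"
    using qfact_tendsto[OF q(2)] .
  have nz: "qfact q n \<noteq> 0" for n
    by (rule qfact_nonzero[OF q(2)])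
  obtain U where U: "\<And>n. norm (qfact q n) \<le> U"
    using convergent_imp_Bseq[of "qfact q"] L(1) unfolding convergent_def Bseq_def by blast
  have "(\<lambda>n. inverse (qfact q n)) \<longlonglongrightarrow> inverse L"
    by (intro tendsto_inverse L)
  then obtain V where V: "\<And>n. norm (inverse (qfact q n)) \<le> V"
    using convergent_imp_Bseq[of "\<lambda>n. inverse (qfact q n)"] unfolding convergent_def Bseq_def by blast
  have U0: "0 \<le> U" and V0: "0 \<le> V"
    using U V norm_ge_zero order_trans by blast+
  define t where "t k = z powi k * q powi tri k" for k
  define a where "a k n = (if - int n \<le> k \<and> k \<le> int n
      then qfact q n * qbinom q (2 * n) (nat (int n + k)) else 0)" for k n
  have a_eq: "a k n = qfact q n * qfact q (2 * n) *
      inverse (qfact q (nat (int n + k))) * inverse (qfact q (nat (int n - k)))"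
    if "- int n \<le> k" "k \<le> int n" for k n
  proof -
    have "2 * n - nat (int n + k) = nat (int n - k)" "nat (int n + k) \<le> 2 * n"
      using that by auto
    then show ?thesis
      using that by (simp add: a_def qbinom_def divide_inverse mult_ac)
  qed
  \<comment> \<open>\<open>a k n\<close> is the coefficient of the finite identity times \<open>qfact q n\<close>; it is bounded and tends
    to 1 because \<open>qfact q\<close> has a nonzero limit, so the sums converge by domination.\<close>
  have a_bound: "norm (a k n) \<le> U * U * V * V" for k n
  proof (cases "- int n \<le> k \<and> k \<le> int n")
    case True
    then show ?thesis
      unfolding a_eq[OF conjunct1[OF True] conjunct2[OF True]] norm_mult
      by (intro mult_mono U V mult_nonneg_nonneg norm_ge_zero U0 V0)
  next
    case False
    then have "a k n = 0" by (auto simp: a_def)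
    then show ?thesis using U0 V0 by simp
  qed
  have a_lim: "a k \<longlonglongrightarrow> 1" for k
  proof -
    have sub: "(\<lambda>n. qfact q (h n)) \<longlonglongrightarrow> L" if "filterlim h at_top sequentially" for h
      by (rule filterlim_compose[OF L(1) that])
    have "filterlim (\<lambda>n. nat (int n + m)) at_top sequentially" for m
      unfolding filterlim_at_top eventually_sequentially
    proof
      fix Z show "\<exists>N. \<forall>n\<ge>N. Z \<le> nat (int n + m)"
        by (rule exI[of _ "Z + nat \<bar>m\<bar>"]) auto
    qed
    from this[of k] this[of "-k"]
    have "(\<lambda>n. qfact q n * qfact q (2 * n) *
        inverse (qfact q (nat (int n + k))) * inverse (qfact q (nat (int n - k)))) \<longlonglongrightarrow>
        L * L * inverse L * inverse L"
      by (intro tendsto_mult tendsto_inverse L sub mult_nat_left_at_top) auto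
    moreover have "\<forall>\<^sub>F n in sequentially. qfact q n * qfact q (2 * n) *
        inverse (qfact q (nat (int n + k))) * inverse (qfact q (nat (int n - k))) = a k n"
      using eventually_ge_at_top[of "nat \<bar>k\<bar>"] by eventually_elim (auto simp: a_eq)
    ultimately have "a k \<longlonglongrightarrow> L * L * inverse L * inverse L"
      by (rule Lim_transform_eventually)
    moreover have "L * L * inverse L * inverse L = 1"
      using L(2) by (simp add: field_simps)
    ultimately show ?thesis by simp
  qed
  have "(\<lambda>n. infsum (\<lambda>k. a k n * t k) UNIV) \<longlonglongrightarrow> infsum t UNIV"
  proof (rule tendsto_infsum_dominated)
    show "(\<lambda>n. a k n * t k) \<longlonglongrightarrow> t k" for k
      using tendsto_mult[OF a_lim tendsto_const, of k "t k"] by simp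
    show "norm (a k n * t k) \<le> U * U * V * V * norm (t k)" for k n
      unfolding norm_mult by (intro mult_right_mono a_bound) simp
    show "(\<lambda>k. U * U * V * V * norm (t k)) summable_on UNIV"
      unfolding t_def by (intro summable_on_cmult_right abs_summable_theta assms)
  qed
  moreover have "infsum (\<lambda>k. a k n * t k) UNIV =
      (\<Prod>i<n. (1 - q ^ Suc i) * (1 + z * q ^ i) * (1 + q ^ Suc i / z))" for n
  proof -
    have "infsum (\<lambda>k. a k n * t k) UNIV = infsum (\<lambda>k. a k n * t k) {- int n..int n}"
      by (rule infsum_cong_neutral) (auto simp: a_def)
    also have "\<dots> = qfact q n *
        (\<Sum>k\<in>{- int n..int n}. qbinom q (2 * n) (nat (int n + k)) * (z powi k * q powi tri k))"
      by (simp add: a_def t_def sum_distrib_left mult.assoc)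
    also have "\<dots> = qfact q n * (\<Prod>i<n. (1 + z * q ^ i) * (1 + q ^ Suc i / z))"
      by (simp only: finite_jacobi_triple_product[OF q(1) z nz])
    finally show ?thesis
      by (simp only: qfact_def prod.distrib mult.assoc)
  qed
  ultimately show ?thesis
    by (simp add: theta_def t_def[abs_def])
qed

section \<open>Theta series and the quintuple product\<close>

lemma has_sum_theta:
  fixes q z :: "'a::{real_normed_field,banach}"
  assumes "q \<noteq> 0" "norm q < 1" "z \<noteq> 0"
  shows "((\<lambda>k. z powi k * q powi tri k) has_sum theta q z) UNIV"
  unfolding theta_def
  by (intro has_sum_infsum abs_summable_summable[OF abs_summable_theta] assms)

text \<open>Absolute summability of both factors licenses the step from iterated sums to a sum over
  pairs.\<close>

lemma has_sum_product:
  fixes f :: "'a \<Rightarrow> 'c::{real_normed_field,banach}" and g :: "'b \<Rightarrow> 'c"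
  assumes f: "f abs_summable_on A" and g: "g abs_summable_on B"
    and a: "(f has_sum a) A" and b: "(g has_sum b) B"
  shows "((\<lambda>(x, y). f x * g y) has_sum (a * b)) (A \<times> B)"
proof (rule has_sum_SigmaI)
  show "((\<lambda>y. (\<lambda>(x, y). f x * g y) (x, y)) has_sum (f x * b)) B" for x
    using has_sum_cmult_right[OF b] by simp
  show "((\<lambda>x. f x * b) has_sum (a * b)) A"
    by (rule has_sum_cmult_left[OF a])
  have "(\<lambda>(x, y). f x * g y) abs_summable_on A \<times> B"
  proof (rule summable_on_SigmaI)
    show "((\<lambda>y. norm (case (x, y) of (x, y) \<Rightarrow> f x * g y)) has_sum
        (norm (f x) * infsum (\<lambda>y. norm (g y)) B)) B" for x
      using has_sum_cmult_right[OF has_sum_infsum[OF g], of "norm (f x)"] by (simp add: norm_mult)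
    show "(\<lambda>x. norm (f x) * infsum (\<lambda>y. norm (g y)) B) summable_on A"
      by (rule summable_on_cmult_left[OF f])
  qed simp
  then show "(\<lambda>(x, y). f x * g y) summable_on A \<times> B"
    by (rule abs_summable_summable)
qed

text \<open>At \<open>z = - q\<close> the factor \<open>1 + q ^ Suc i / z\<close> with
  \<open>i = 0\<close> vanishes, so every nonempty partial product is 0.\<close>

lemma theta_minus_base:
  fixes q :: "'a::{real_normed_field,banach}"
  assumes "q \<noteq> 0" "norm q < 1"
  shows "theta q (- q) = 0"
proof -
  have "(\<lambda>n. \<Prod>i<n. (1 - q ^ Suc i) * (1 + (- q) * q ^ i) * (1 + q ^ Suc i / (- q))) \<longlonglongrightarrow> theta q (- q)"
    by (rule jacobi_triple_product) (use assms in auto)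
  moreover have "\<forall>\<^sub>F n in sequentially.
      (\<Prod>i<n. (1 - q ^ Suc i) * (1 + (- q) * q ^ i) * (1 + q ^ Suc i / (- q))) = 0"
    using eventually_gt_at_top[of 0]
    by eventually_elim (use assms in \<open>auto intro!: bexI[of _ 0]\<close>)
  ultimately have "(\<lambda>n. 0) \<longlonglongrightarrow> theta q (- q)"
    by (rule Lim_transform_eventually)
  then show ?thesis
    by (simp add: LIMSEQ_const_iff)
qed

lemma power_int_minus_sgn:
  "(- a :: 'a::field) powi k = (if even k then 1 else - 1) * a powi k"
  by (simp add: power_int_minus_left)

text \<open>
  The left side is a double series over \<open>(m, n)\<close> in which \<open>z\<close> has exponent \<open>m + 2 * n\<close>. On each
  residue class of that exponent modulo 3, completing the square separates the variables; on the
  class of 2 the inner series is \<open>theta (q ^ 6) (- (q ^ 6)) = 0\<close>.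
\<close>
theorem quintuple_product:
  fixes q z :: "'a::{real_normed_field,banach}"
  assumes q: "q \<noteq> 0" "norm q < 1" and z: "z \<noteq> 0"
  shows "theta q (- z) * theta (q\<^sup>2) (- (z\<^sup>2 * q)) =
    theta (q ^ 6) (- (q ^ 4)) * (theta (q ^ 3) (z ^ 3 * q) - z * theta (q ^ 3) (z ^ 3 * q\<^sup>2))"
proof -
  define f where "f p k = (snd p powi k * fst p powi tri k :: 'a)" for p k
  define h where "h = (\<lambda>(m, n). f (q, - z) m * f (q\<^sup>2, - (z\<^sup>2 * q)) n)"
  have small: "norm (q ^ n) < 1" if "n > 0" for n
    using q(2) that by (simp add: norm_power power_less_one_iff)
  have prod: "((\<lambda>(j, l). f (q ^ a, y) j * f (q ^ b, w) l) has_sum theta (q ^ a) y * theta (q ^ b) w) (UNIV \<times> UNIV)"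
    if "a > 0" "b > 0" "y \<noteq> 0" "w \<noteq> 0" for a b y w
    unfolding f_def fst_conv snd_conv
    by (intro has_sum_product abs_summable_theta has_sum_theta small that) (use q in auto)
  have h: "(h has_sum theta q (- z) * theta (q\<^sup>2) (- (z\<^sup>2 * q))) UNIV"
    using prod[of 1 2 "- z" "- (z\<^sup>2 * q)"] q z by (simp add: h_def)
  have f_eq: "f (q ^ a, e * (z ^ b * q ^ c)) k = e powi k * z powi (b * k) * q powi (c * k + a * tri k)" for a b c e k
    using q by (simp add: f_def power_int_mult_distrib power_int_power power_int_add mult_ac)
  have h_eq: "h (m, n) = (if even (m + n) then 1 else - 1) * z powi (m + 2 * n) * q powi (tri m + n + 2 * tri n)" for m n
    using f_eq[of 1 "-1" 1 0 m] f_eq[of 2 "-1" 2 1 n] q z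
    by (simp add: h_def power_int_minus_sgn power_int_add)
  \<comment> \<open>The quadratic part of the exponent of \<open>q\<close> is half of
    \<open>m ^ 2 + 2 * n ^ 2\<close>. Putting \<open>m = j - 2 * l\<close> and
    \<open>n = j + l\<close> removes the mixed term and leaves half of
    \<open>3 * j ^ 2 + 6 * l ^ 2\<close>, whence the bases \<open>q ^ 3\<close> and
    \<open>q ^ 6\<close>.\<close>
  have p0: "f (q ^ 3, z ^ 3 * q) j * f (q ^ 6, - (q ^ 4)) l = h (j - 2 * l, j + l)" for j l
  proof -
    have "2 * (tri (j - 2 * l) + (j + l) + 2 * tri (j + l)) = 2 * (j + 3 * tri j + (4 * l + 6 * tri l))"
      using two_tri[of "j - 2 * l"] two_tri[of "j + l"] two_tri[of j] two_tri[of l]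
      by (simp add: algebra_simps)
    then have e: "tri (j - 2 * l) + (j + l) + 2 * tri (j + l) = (j + 3 * tri j) + (4 * l + 6 * tri l)"
      by simp
    have a: "f (q ^ 3, z ^ 3 * q) j = z powi (3 * j) * q powi (j + 3 * tri j)"
      using f_eq[of 3 1 3 1 j] by simp
    have b: "f (q ^ 6, - (q ^ 4)) l = (if even l then 1 else - 1) * q powi (4 * l + 6 * tri l)"
      using f_eq[of 6 "-1" 0 4 l] by (simp add: power_int_minus_sgn)
    have "h (j - 2 * l, j + l) = (if even l then 1 else - 1) * z powi (3 * j) * q powi ((j + 3 * tri j) + (4 * l + 6 * tri l))"
      unfolding h_eq e by (simp add: algebra_simps)
    then show ?thesis
      unfolding a b using q by (simp add: power_int_add)
  qed
  \<comment> \<open>Compared with \<open>p0\<close> the sign of \<open>l\<close> is reversed, so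
    that the same factor with argument \<open>- (q ^ 4)\<close> appears instead of its reflection
    with \<open>- (q ^ 2)\<close>.\<close>
  have p1: "- z * (f (q ^ 3, z ^ 3 * q\<^sup>2) j * f (q ^ 6, - (q ^ 4)) l) = h (j + 1 + 2 * l, j - l)" for j l
  proof -
    have "2 * (tri (j + 1 + 2 * l) + (j - l) + 2 * tri (j - l)) = 2 * (2 * j + 3 * tri j + (4 * l + 6 * tri l))"
      using two_tri[of "j + 1 + 2 * l"] two_tri[of "j - l"] two_tri[of j] two_tri[of l]
      by (simp add: algebra_simps)
    then have e: "tri (j + 1 + 2 * l) + (j - l) + 2 * tri (j - l) = (2 * j + 3 * tri j) + (4 * l + 6 * tri l)"
      by simp
    have a: "f (q ^ 3, z ^ 3 * q\<^sup>2) j = z powi (3 * j) * q powi (2 * j + 3 * tri j)"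
      using f_eq[of 3 1 3 2 j] by simp
    have b: "f (q ^ 6, - (q ^ 4)) l = (if even l then 1 else - 1) * q powi (4 * l + 6 * tri l)"
      using f_eq[of 6 "-1" 0 4 l] by (simp add: power_int_minus_sgn)
    have "j + 1 + 2 * l + 2 * (j - l) = 3 * j + 1" by simp
    then have "h (j + 1 + 2 * l, j - l) = (if even l then - 1 else 1) * z powi (3 * j + 1) *
        q powi ((2 * j + 3 * tri j) + (4 * l + 6 * tri l))"
      unfolding h_eq e by simp
    then show ?thesis
      unfolding a b using q z by (simp add: power_int_add)
  qed
  \<comment> \<open>The class of 2 is reached as \<open>m + 2 * n = 3 * j - 1\<close>; with this
    offset the exponent is linear in \<open>l\<close> with coefficient 6, hence the argument
    \<open>- (q ^ 6)\<close>.\<close>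
  have p2: "- (q / z) * (f (q ^ 3, z ^ 3 * 1) j * f (q ^ 6, - (q ^ 6)) l) = h (j - 1 - 2 * l, j + l)" for j l
  proof -
    have "2 * (tri (j - 1 - 2 * l) + (j + l) + 2 * tri (j + l)) = 2 * (1 + 3 * tri j + (6 * l + 6 * tri l))"
      using two_tri[of "j - 1 - 2 * l"] two_tri[of "j + l"] two_tri[of j] two_tri[of l]
      by (simp add: algebra_simps)
    then have e: "tri (j - 1 - 2 * l) + (j + l) + 2 * tri (j + l) = (1 + 3 * tri j) + (6 * l + 6 * tri l)"
      by simp
    have a: "f (q ^ 3, z ^ 3 * 1) j = z powi (3 * j) * q powi (3 * tri j)"
      using f_eq[of 3 1 3 0 j] by simp
    have b: "f (q ^ 6, - (q ^ 6)) l = (if even l then 1 else - 1) * q powi (6 * l + 6 * tri l)"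
      using f_eq[of 6 "-1" 0 6 l] by (simp add: power_int_minus_sgn)
    have "j - 1 - 2 * l + 2 * (j + l) = 3 * j - 1" by simp
    then have "h (j - 1 - 2 * l, j + l) = (if even l then - 1 else 1) * z powi (3 * j - 1) *
        q powi ((1 + 3 * tri j) + (6 * l + 6 * tri l))"
      unfolding h_eq e by simp
    then show ?thesis
      unfolding a b using q z by (simp add: power_int_add power_int_diff)
  qed
  define g0 g1 g2 :: "int \<times> int \<Rightarrow> int \<times> int"
    where "g0 = (\<lambda>(j, l). (j - 2 * l, j + l))"
      and "g1 = (\<lambda>(j, l). (j + 1 + 2 * l, j - l))"
      and "g2 = (\<lambda>(j, l). (j - 1 - 2 * l, j + l))"
  have inj: "inj g0" "inj g1" "inj g2"
    by (auto simp: g0_def g1_def g2_def inj_def)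
  have 0: "(h has_sum theta (q ^ 3) (z ^ 3 * q) * theta (q ^ 6) (- (q ^ 4))) (range g0)"
    using prod[of 3 6 "z ^ 3 * q" "- (q ^ 4)"] q z
    by (subst has_sum_reindex[OF inj(1)]) (simp add: g0_def o_def case_prod_unfold p0)
  have 1: "(h has_sum - z * (theta (q ^ 3) (z ^ 3 * q\<^sup>2) * theta (q ^ 6) (- (q ^ 4)))) (range g1)"
    using has_sum_cmult_right[OF prod[of 3 6 "z ^ 3 * q\<^sup>2" "- (q ^ 4)"], of "- z"] q z
    by (subst has_sum_reindex[OF inj(2)]) (simp add: g1_def o_def case_prod_unfold flip: p1)
  have 2: "(h has_sum - (q / z) * (theta (q ^ 3) (z ^ 3 * 1) * theta (q ^ 6) (- (q ^ 6)))) (range g2)"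
    using has_sum_cmult_right[OF prod[of 3 6 "z ^ 3 * 1" "- (q ^ 6)"], of "- (q / z)"] q z
    by (subst has_sum_reindex[OF inj(3)]) (simp add: g2_def o_def case_prod_unfold flip: p2)
  \<comment> \<open>The exponent of \<open>z\<close>, whose residue modulo 3 keeps the three images
    apart.\<close>
  define w where "w p = fst p + 2 * snd p" for p :: "int \<times> int"
  have w: "w (g0 p) = 3 * fst p" "w (g1 p) = 3 * fst p + 1" "w (g2 p) = 3 * fst p - 1" for p
    by (simp_all add: w_def g0_def g1_def g2_def case_prod_unfold)
  have "w (g0 p) \<noteq> w (g1 p')" "w (g0 p) \<noteq> w (g2 p')" "w (g1 p) \<noteq> w (g2 p')" for p p'
    unfolding w by presburger+
  then have "g0 p \<noteq> g1 p'" "g0 p \<noteq> g2 p'" "g1 p \<noteq> g2 p'" for p p'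
    by metis+
  then have disj: "range g0 \<inter> range g1 = {}" "(range g0 \<union> range g1) \<inter> range g2 = {}"
    by blast+
  have "p \<in> range g0 \<union> range g1 \<union> range g2" for p
  proof -
    obtain m n where p: "p = (m, n)" by fastforce
    \<comment> \<open>Rounding to the nearest multiple of 3 serves the remainders 0, 1 and -1
      alike.\<close>
    define j where "j = (m + 2 * n + 1) div 3"
    have "m + 2 * n = 3 * j \<or> m + 2 * n = 3 * j + 1 \<or> m + 2 * n = 3 * j - 1"
      unfolding j_def by presburger
    then consider "m + 2 * n = 3 * j" | "m + 2 * n = 3 * j + 1" | "m + 2 * n = 3 * j - 1"
      by blast
    then show ?thesis
    proof cases
      case 1
      then have "p = g0 (j, n - j)" by (simp add: g0_def p)
      then show ?thesis by blast
    next
      case 2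
      then have "p = g1 (j, j - n)" by (simp add: g1_def p)
      then show ?thesis by blast
    next
      case 3
      then have "p = g2 (j, n - j)" by (simp add: g2_def p)
      then show ?thesis by blast
    qed
  qed
  then have "range g0 \<union> range g1 \<union> range g2 = UNIV"
    by blast
  with has_sum_Un_disjoint[OF has_sum_Un_disjoint[OF 0 1 disj(1)] 2 disj(2)]
  have "(h has_sum theta (q ^ 3) (z ^ 3 * q) * theta (q ^ 6) (- (q ^ 4)) +
      - z * (theta (q ^ 3) (z ^ 3 * q\<^sup>2) * theta (q ^ 6) (- (q ^ 4)))) UNIV"
    using theta_minus_base[of "q ^ 6"] q small[of 6] by simp
  from has_sum_unique[OF h this] show ?thesis
    by (simp add: algebra_simps)
qed

section \<open>Transformations and dissections of theta series\<close>

lemma theta_reflect: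
  fixes q z :: "'a::{real_normed_field,banach}"
  assumes "q \<noteq> 0" "z \<noteq> 0"
  shows "theta q z = theta q (q / z)"
proof -
  \<comment> \<open>Under the reflection of \<open>k\<close>, \<open>tri (- k) = tri k + k\<close>
    accounts for the extra power of \<open>q\<close>.\<close>
  have e: "(q / z) powi k * q powi tri k = z powi (- k) * q powi tri (- k)" for k
    using assms by (simp add: tri_neg power_int_add power_int_minus power_int_mult_distrib power_int_inverse divide_inverse)
  have "bij (uminus :: int \<Rightarrow> int)"
    by (metis bijI' minus_minus equation_minus_iff)
  then show ?thesis
    using infsum_reindex_bij_betw[of uminus UNIV UNIV "\<lambda>k. z powi k * q powi tri k"]
    by (simp add: theta_def e)
qed

lemma theta_shift:
  fixes q z :: "'a::{real_normed_field,banach}"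
  assumes "q \<noteq> 0" "z \<noteq> 0"
  shows "theta q z = z * theta q (z * q)"
proof -
  have e: "z powi (k + 1) * q powi tri (k + 1) = z * ((z * q) powi k * q powi tri k)" for k
    using assms by (simp add: tri_add power_int_add power_int_mult_distrib)
  have "bij (\<lambda>k. k + 1 :: int)"
    by (rule bijI'[of "\<lambda>k. k + 1"]) (auto intro: exI[of _ "_ - 1"])
  then show ?thesis
    using infsum_reindex_bij_betw[of "\<lambda>k. k + 1" UNIV UNIV "\<lambda>k. z powi k * q powi tri k"]
    by (simp add: theta_def e infsum_cmult_right')
qed

text \<open>Indices are split as \<open>k = m * j + r\<close>. In \<open>tri (m * j + r)\<close> the
  part quadratic in \<open>j\<close> is \<open>m ^ 2 * tri j\<close>, which gives the new base; the
  linear rest goes into the argument.\<close>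

lemma theta_dissection:
  fixes q z :: "'a::{real_normed_field,banach}"
  assumes q: "q \<noteq> 0" "norm q < 1" and z: "z \<noteq> 0" and m: "m > 0"
  shows "theta q z = (\<Sum>r<m. z ^ r * q powi tri (int r) *
    theta (q ^ m\<^sup>2) (z ^ m * q powi (tri (int m) + int m * int r)))"
proof -
  define t where "t k = z powi k * q powi tri k" for k
  define g where "g = (\<lambda>(r, j). int m * j + int r)"
  have bij: "bij_betw g ({..<m} \<times> UNIV) UNIV"
  proof (rule bij_betwI[where g = "\<lambda>k. (nat (k mod int m), k div int m)"])
    show "(\<lambda>k. (nat (k mod int m), k div int m)) \<in> UNIV \<rightarrow> {..<m} \<times> UNIV"
      using m by (auto simp: nat_less_iff)
  qed (use m in \<open>auto simp: g_def\<close>)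
  have "((\<lambda>p. t (g p)) has_sum theta q z) ({..<m} \<times> UNIV)"
    using has_sum_theta[OF q z] has_sum_reindex_bij_betw[OF bij, of t] by (simp add: t_def[abs_def])
  moreover have "((\<lambda>j. t (g (r, j))) has_sum (z ^ r * q powi tri (int r) *
      theta (q ^ m\<^sup>2) (z ^ m * q powi (tri (int m) + int m * int r)))) UNIV" for r
  proof -
    define b where "b = tri (int m) + int m * int r"
    have e: "t (g (r, j)) = z ^ r * q powi tri (int r) * ((z ^ m * q powi b) powi j * (q ^ m\<^sup>2) powi tri j)" for j
    proof -
      have "2 * tri (int m * j) = (int m)\<^sup>2 * (2 * tri j) + (2 * tri (int m)) * j"
        unfolding two_tri by (simp add: algebra_simps power2_eq_square)
      then have "tri (int m * j + int r) = tri (int r) + (b * j + (int m)\<^sup>2 * tri j)"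
        by (simp add: tri_add b_def algebra_simps)
      then show ?thesis
        using q z by (simp add: t_def g_def power_int_add power_int_mult_distrib power_int_power
          flip: power_int_mult)
    qed
    show ?thesis
      unfolding e b_def[symmetric] using q z m
      by (intro has_sum_cmult_right has_sum_theta) (auto simp: norm_power power_less_one_iff)
  qed
  ultimately have "((\<lambda>r. z ^ r * q powi tri (int r) *
      theta (q ^ m\<^sup>2) (z ^ m * q powi (tri (int m) + int m * int r))) has_sum theta q z) {..<m}"
    by (rule has_sum_SigmaD)
  then show ?thesis
    using has_sum_unique[OF _ has_sum_finite] by blast
qed

text \<open>The way back to the reals after evaluation at a cube root of unity.\<close>

lemma theta_of_real:
  fixes q z :: real
  assumes "q \<noteq> 0" "\<bar>q\<bar> < 1" "z \<noteq> 0"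
  shows "theta (complex_of_real q) (complex_of_real z) = complex_of_real (theta q z)"
proof (rule has_sum_unique)
  show "((\<lambda>k. complex_of_real z powi k * complex_of_real q powi tri k) has_sum
      theta (complex_of_real q) (complex_of_real z)) UNIV"
    by (rule has_sum_theta) (use assms in auto)
  show "((\<lambda>k. complex_of_real z powi k * complex_of_real q powi tri k) has_sum
      complex_of_real (theta q z)) UNIV"
    using has_sum_of_real[OF has_sum_theta[of q z], where 'a = complex] assms
    by (simp flip: of_real_power_int)
qed

section \<open>Products over residue classes\<close>

text \<open>Only the positive elements of \<open>S\<close> contribute.\<close>
definition euler_prod :: "nat set \<Rightarrow> real \<Rightarrow> real" where
  "euler_prod S x = (\<Prod>i. if Suc i \<in> S then 1 - x ^ Suc i else 1)"

lemma convergent_euler_prod: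
  assumes "0 \<le> x" "x < 1"
  shows "convergent_prod (\<lambda>i. if Suc i \<in> S then 1 - x ^ Suc i else 1 :: real)"
proof (rule abs_convergent_prod_imp_convergent_prod, unfold abs_convergent_prod_conv_summable)
  have "summable (\<lambda>i. x ^ Suc i)"
    unfolding summable_Suc_iff using assms by (simp add: summable_geometric)
  then show "summable (\<lambda>i. norm ((if Suc i \<in> S then 1 - x ^ Suc i else 1) - 1))"
    by (rule summable_comparison_test'[where N = 0]) (use assms in auto)
qed

lemma euler_prod_tendsto:
  assumes "0 \<le> x" "x < 1"
  shows "(\<lambda>n. \<Prod>k\<in>S \<inter> {0<..n}. 1 - x ^ k) \<longlonglongrightarrow> euler_prod S x"
proof -
  have "(\<Prod>i\<le>n. if Suc i \<in> S then 1 - x ^ Suc i else 1) = (\<Prod>k\<in>S \<inter> {0<..Suc n}. 1 - x ^ k)" for n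
  proof -
    have "(\<Prod>i\<le>n. if Suc i \<in> S then 1 - x ^ Suc i else 1) = (\<Prod>k\<in>Suc ` {..n}. if k \<in> S then 1 - x ^ k else 1)"
      by (subst prod.reindex) auto
    also have "Suc ` {..n} = {0<..Suc n}"
      by (auto simp: image_iff) (metis Suc_pred' Suc_le_mono atMost_iff)
    finally show ?thesis
      by (simp add: prod.inter_restrict Int_commute[of S])
  qed
  then have "(\<lambda>n. \<Prod>k\<in>S \<inter> {0<..Suc n}. 1 - x ^ k) \<longlonglongrightarrow> euler_prod S x"
    using convergent_prod_LIMSEQ[OF convergent_euler_prod[OF assms, of S]] by (simp only: euler_prod_def)
  then show ?thesis
    by (rule LIMSEQ_imp_Suc)
qed

lemma euler_prod_pos:
  assumes "0 \<le> x" "x < 1"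
  shows "euler_prod S x > 0"
  unfolding euler_prod_def
proof (rule less_0_prodinf[OF convergent_euler_prod[OF assms]])
  fix i
  have "x ^ Suc i < 1" using assms by (simp only: power_less_one_iff) simp
  then show "0 < (if Suc i \<in> S then 1 - x ^ Suc i else 1)" by simp
qed

lemma euler_prod_cong:
  assumes "\<And>k. k > 0 \<Longrightarrow> k \<in> S \<longleftrightarrow> k \<in> T"
  shows "euler_prod S x = euler_prod T x"
  using assms by (simp add: euler_prod_def)

lemma euler_prod_Un:
  assumes "0 \<le> x" "x < 1" "S \<inter> T = {}"
  shows "euler_prod (S \<union> T) x = euler_prod S x * euler_prod T x"
proof -
  have "euler_prod S x * euler_prod T x = (\<Prod>i. (if Suc i \<in> S then 1 - x ^ Suc i else 1) *
      (if Suc i \<in> T then 1 - x ^ Suc i else 1))"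
    unfolding euler_prod_def by (intro prodinf_mult convergent_euler_prod assms)
  also have "\<dots> = euler_prod (S \<union> T) x"
    unfolding euler_prod_def using assms(3) by (intro prodinf_cong) auto
  finally show ?thesis ..
qed

text \<open>The representative \<open>r\<close> lies in 1..m, so that \<open>i = 0\<close> gives the
  least positive member of the class; residue 0 is \<open>r = m\<close>. Cutting off at
  \<open>m * n\<close> leaves exactly n members.\<close>

lemma euler_prod_progression:
  assumes x: "0 \<le> x" "x < 1" and r: "0 < r" "r \<le> m"
  shows "(\<lambda>n. \<Prod>i<n. 1 - x ^ (m * i + r)) \<longlonglongrightarrow> euler_prod {k. k mod m = r mod m} x"
proof -
  have "filterlim (\<lambda>n. m * n) at_top sequentially"
    using r by (intro mult_nat_left_at_top) auto
  from filterlim_compose[OF euler_prod_tendsto[OF x] this]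
  have "(\<lambda>n. \<Prod>k\<in>{k. k mod m = r mod m} \<inter> {0<..m * n}. 1 - x ^ k) \<longlonglongrightarrow> euler_prod {k. k mod m = r mod m} x" .
  moreover have "(\<Prod>k\<in>{k. k mod m = r mod m} \<inter> {0<..m * n}. 1 - x ^ k) = (\<Prod>i<n. 1 - x ^ (m * i + r))" for n
  proof -
    have "{k. k mod m = r mod m} \<inter> {0<..m * n} = (\<lambda>i. m * i + r) ` {..<n}"
    proof (intro equalityI subsetI)
      fix k assume "k \<in> {k. k mod m = r mod m} \<inter> {0<..m * n}"
      then have k: "k mod m = r mod m" "0 < k" "k \<le> m * n" by auto
      have "r \<le> k"
      proof (cases "r = m")
        case True
        then show ?thesis using k by (auto simp: dvd_imp_le)
      next
        case False
        then show ?thesis using k r by (metis le_neq_implies_less mod_less mod_less_eq_dividend)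
      qed
      moreover have "m dvd k - r"
        using k(1) \<open>r \<le> k\<close> by (metis mod_eq_dvd_iff_nat)
      then obtain i where "k - r = m * i" ..
      ultimately have i: "k = m * i + r" by simp
      with k r have "m * i < m * n" by linarith
      then show "k \<in> (\<lambda>i. m * i + r) ` {..<n}" using i by auto
    next
      fix k assume "k \<in> (\<lambda>i. m * i + r) ` {..<n}"
      then obtain i where i: "i < n" "k = m * i + r" by auto
      have "m * Suc i \<le> m * n" using i by (intro mult_le_mono) auto
      with i r show "k \<in> {k. k mod m = r mod m} \<inter> {0<..m * n}" by auto
    qed
    moreover have "inj_on (\<lambda>i. m * i + r) {..<n}" using r by (auto simp: inj_on_def)
    ultimately show ?thesis by (simp add: prod.reindex)
  qed
  ultimately show ?thesis by simp
qed

lemma euler_prod_power: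
  assumes x: "0 \<le> x" "x < 1" and m: "m > 0"
  shows "euler_prod S (x ^ m) = euler_prod ((*) m ` S) x"
proof (rule LIMSEQ_unique)
  show "(\<lambda>n. \<Prod>k\<in>S \<inter> {0<..n}. 1 - (x ^ m) ^ k) \<longlonglongrightarrow> euler_prod S (x ^ m)"
    using assms by (intro euler_prod_tendsto) (auto simp: power_less_one_iff)
  have "filterlim (\<lambda>n. m * n) at_top sequentially"
    using m by (intro mult_nat_left_at_top) auto
  from filterlim_compose[OF euler_prod_tendsto[OF x] this]
  have "(\<lambda>n. \<Prod>k\<in>(*) m ` S \<inter> {0<..m * n}. 1 - x ^ k) \<longlonglongrightarrow> euler_prod ((*) m ` S) x" .
  moreover have "(\<Prod>k\<in>(*) m ` S \<inter> {0<..m * n}. 1 - x ^ k) = (\<Prod>k\<in>S \<inter> {0<..n}. 1 - (x ^ m) ^ k)" for n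
  proof -
    have "(*) m ` S \<inter> {0<..m * n} = (*) m ` (S \<inter> {0<..n})" using m by auto
    then show ?thesis using m by (simp add: prod.reindex inj_on_def power_mult)
  qed
  ultimately show "(\<lambda>n. \<Prod>k\<in>S \<inter> {0<..n}. 1 - (x ^ m) ^ k) \<longlonglongrightarrow> euler_prod ((*) m ` S) x"
    by simp
qed

text \<open>The three families of factors in the triple product run through the residues 0,
  \<open>a\<close> and \<open>m - a\<close>. For \<open>2 * a = m\<close> the last two coincide and
  that class counts twice.\<close>

lemma theta_euler_prod:
  assumes x: "0 < x" "x < 1" and a: "0 < a" "a < m"
  shows "theta (x ^ m) (- (x ^ a)) =
    euler_prod {k. k mod m = 0} x * euler_prod {k. k mod m = a} x * euler_prod {k. k mod m = m - a} x"
proof (rule LIMSEQ_unique)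
  show "(\<lambda>n. \<Prod>i<n. (1 - (x ^ m) ^ Suc i) * (1 + - (x ^ a) * (x ^ m) ^ i) * (1 + (x ^ m) ^ Suc i / - (x ^ a)))
      \<longlonglongrightarrow> theta (x ^ m) (- (x ^ a))"
    by (rule jacobi_triple_product) (use x a in \<open>auto simp: power_less_one_iff\<close>)
  have "(x ^ m) ^ Suc i = x ^ (m * i + m)" "1 + - (x ^ a) * (x ^ m) ^ i = 1 - x ^ (m * i + a)"
    "1 + (x ^ m) ^ Suc i / - (x ^ a) = 1 - x ^ (m * i + (m - a))" for i
    using x a by (simp_all add: power_add power_mult power_diff)
  then have "(\<Prod>i<n. (1 - (x ^ m) ^ Suc i) * (1 + - (x ^ a) * (x ^ m) ^ i) * (1 + (x ^ m) ^ Suc i / - (x ^ a)))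
     = (\<Prod>i<n. 1 - x ^ (m * i + m)) * (\<Prod>i<n. 1 - x ^ (m * i + a)) * (\<Prod>i<n. 1 - x ^ (m * i + (m - a)))" for n
    by (simp only: prod.distrib)
  moreover have "(\<lambda>n. (\<Prod>i<n. 1 - x ^ (m * i + m)) * (\<Prod>i<n. 1 - x ^ (m * i + a)) * (\<Prod>i<n. 1 - x ^ (m * i + (m - a))))
     \<longlonglongrightarrow> euler_prod {k. k mod m = 0} x * euler_prod {k. k mod m = a} x * euler_prod {k. k mod m = m - a} x"
    using euler_prod_progression[of x m m] euler_prod_progression[of x a m]
      euler_prod_progression[of x "m - a" m] x a
    by (intro tendsto_mult) auto
  ultimately show "(\<lambda>n. \<Prod>i<n. (1 - (x ^ m) ^ Suc i) * (1 + - (x ^ a) * (x ^ m) ^ i) * (1 + (x ^ m) ^ Suc i / - (x ^ a)))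
      \<longlonglongrightarrow> euler_prod {k. k mod m = 0} x * euler_prod {k. k mod m = a} x * euler_prod {k. k mod m = m - a} x"
    by simp
qed

lemma theta_even_odd:
  fixes q z :: "'a::{real_normed_field,banach}"
  assumes "q \<noteq> 0" "norm q < 1" "z \<noteq> 0"
  shows "theta q z = theta (q ^ 4) (z\<^sup>2 * q) + z * theta (q ^ 4) (z\<^sup>2 * q ^ 3)"
proof -
  have "{..<2 :: nat} = {0, 1}" by auto
  then show ?thesis
    using theta_dissection[OF assms, of 2] by (simp add: tri_def)
qed

lemma theta_trisection:
  fixes q z :: "'a::{real_normed_field,banach}"
  assumes "q \<noteq> 0" "norm q < 1" "z \<noteq> 0"
  shows "theta q z = theta (q ^ 9) (z ^ 3 * q ^ 3) + z * theta (q ^ 9) (z ^ 3 * q ^ 6)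
    + z\<^sup>2 * q * theta (q ^ 9) (z ^ 3 * q ^ 9)"
proof -
  have "{..<3 :: nat} = {0, 1, 2}" by auto
  then show ?thesis
    using theta_dissection[OF assms, of 3] by (simp add: tri_def add.assoc)
qed

text \<open>The triple product at a primitive cube root of unity \<open>w\<close>: as
  \<open>w + 1 / w = - 1\<close>, factors pair up to \<open>1 - t + t ^ 2\<close>. After trisection
  only cubes of \<open>w\<close> remain in the theta arguments.\<close>

lemma prod_tendsto_theta_cube_root:
  fixes y :: real
  assumes y: "0 < y" "y < 1"
  shows "(\<lambda>n. \<Prod>i<n. (1 - y ^ Suc i) * (1 - y ^ Suc i + (y ^ Suc i)\<^sup>2))
    \<longlonglongrightarrow> theta (y ^ 9) (y ^ 3) - y * theta (y ^ 9) (y ^ 9)"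
proof -
  define w where "w = Complex (- 1 / 2) (sqrt 3 / 2)"
  define q where "q = complex_of_real y"
  define P where "P n = (\<Prod>i<n. (1 - q ^ Suc i) * (1 - q ^ Suc i + (q ^ Suc i)\<^sup>2))" for n
  have w2: "w\<^sup>2 = - 1 - w"
    by (simp add: w_def power2_eq_square complex_eq_iff)
  have w3: "w ^ 3 = 1"
    by (simp add: w_def power3_eq_cube complex_eq_iff)
  have w0: "w \<noteq> 0" and w1: "1 + w \<noteq> 0"
    by (simp_all add: w_def complex_eq_iff)
  have inv: "1 / w = w\<^sup>2"
    using w3 w0 by (simp add: field_simps power3_eq_cube power2_eq_square)
  have q: "q \<noteq> 0" "norm q < 1"
    using y by (simp_all add: q_def)
  have fac: "(1 + w * t) * (1 + t / w) = 1 - t + t\<^sup>2" for t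
  proof -
    have "(1 + w * t) * (1 + t / w) = 1 + (w + 1 / w) * t + t\<^sup>2"
      using w0 by (simp add: field_simps power2_eq_square)
    then show ?thesis unfolding inv w2 by simp
  qed
  \<comment> \<open>The two families containing \<open>w\<close> are offset by one index: the first
    begins with the unpaired \<open>1 + w\<close> and lacks \<open>1 + w * q ^ n\<close>, which is
    supplied here and tends to 1.\<close>
  have eq: "(\<Prod>i<n. (1 - q ^ Suc i) * (1 + w * q ^ i) * (1 + q ^ Suc i / w)) * (1 + w * q ^ n) = (1 + w) * P n" for n
  proof (induction n)
    case (Suc n)
    have "(\<Prod>i<Suc n. (1 - q ^ Suc i) * (1 + w * q ^ i) * (1 + q ^ Suc i / w)) * (1 + w * q ^ Suc n) =
      ((\<Prod>i<n. (1 - q ^ Suc i) * (1 + w * q ^ i) * (1 + q ^ Suc i / w)) * (1 + w * q ^ n)) *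
      ((1 - q ^ Suc n) * ((1 + w * q ^ Suc n) * (1 + q ^ Suc n / w)))"
      by (simp only: prod.lessThan_Suc mult_ac)
    then show ?case
      unfolding Suc.IH fac by (simp add: P_def mult_ac)
  qed (simp add: P_def)
  have "(\<lambda>n. w * q ^ n) \<longlonglongrightarrow> w * 0"
    using q by (intro tendsto_intros LIMSEQ_power_zero)
  then have "(\<lambda>n. (\<Prod>i<n. (1 - q ^ Suc i) * (1 + w * q ^ i) * (1 + q ^ Suc i / w)) * (1 + w * q ^ n))
      \<longlonglongrightarrow> theta q w * (1 + w * 0)"
    by (intro tendsto_intros jacobi_triple_product q w0)
  then have "(\<lambda>n. (1 + w) * P n / (1 + w)) \<longlonglongrightarrow> theta q w / (1 + w)"
    unfolding eq using w1 by (intro tendsto_intros) auto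
  then have lim: "P \<longlonglongrightarrow> theta q w / (1 + w)"
    using w1 by simp
  have nz: "q ^ 9 \<noteq> 0" "q ^ 3 \<noteq> 0" using q by auto
  have "q ^ 9 / q ^ 3 = q ^ 6" using q by (simp add: field_simps flip: power_add)
  then have "theta (q ^ 9) (q ^ 6) = theta (q ^ 9) (q ^ 3)"
    using theta_reflect[OF nz] by simp
  then have "theta q w = (1 + w) * theta (q ^ 9) (q ^ 3) + w\<^sup>2 * q * theta (q ^ 9) (q ^ 9)"
    using theta_trisection[OF q w0] by (simp add: w3 distrib_right)
  \<comment> \<open>Since \<open>w ^ 2 = - (1 + w)\<close>, the factor \<open>1 + w\<close> splits
    off and will cancel.\<close>
  also have "\<dots> = (1 + w) * (theta (q ^ 9) (q ^ 3) - q * theta (q ^ 9) (q ^ 9))"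
    unfolding w2 by (simp add: algebra_simps)
  finally have "theta q w / (1 + w) = theta (q ^ 9) (q ^ 3) - q * theta (q ^ 9) (q ^ 9)"
    using w1 by simp
  also have "\<dots> = complex_of_real (theta (y ^ 9) (y ^ 3) - y * theta (y ^ 9) (y ^ 9))"
    unfolding q_def of_real_power[symmetric]
    by (subst (1 2) theta_of_real) (use y in \<open>auto simp: power_less_one_iff\<close>)
  finally have "P \<longlonglongrightarrow> complex_of_real (theta (y ^ 9) (y ^ 3) - y * theta (y ^ 9) (y ^ 9))"
    using lim by simp
  moreover have "P = (\<lambda>n. complex_of_real (\<Prod>i<n. (1 - y ^ Suc i) * (1 - y ^ Suc i + (y ^ Suc i)\<^sup>2)))"
    by (rule ext) (simp add: P_def q_def)
  ultimately show ?thesis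
    by (simp only: tendsto_of_real_iff)
qed

lemma euler_prod_residues:
  assumes "0 \<le> x" "x < 1" "finite R"
  shows "euler_prod {k. k mod m \<in> R} x = (\<Prod>r\<in>R. euler_prod {k. k mod m = r} x)"
  using assms(3)
proof induction
  case empty
  then show ?case by (simp add: euler_prod_def)
next
  case (insert r R)
  have "{k. k mod m \<in> insert r R} = {k. k mod m = r} \<union> {k. k mod m \<in> R}" by auto
  moreover have "{k. k mod m = r} \<inter> {k. k mod m \<in> R} = {}" using insert by auto
  ultimately show ?case
    using insert assms by (simp add: euler_prod_Un)
qed

section \<open>The four numerator products as theta series in base \<open>x ^ 72\<close>\<close>

context
  fixes x :: real
  assumes x: "0 < x" "x < 1"
begin

lemma power_less_one: "n > 0 \<Longrightarrow> x ^ n < 1"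
  using x by (simp add: power_less_one_iff)

text \<open>Euler's pentagonal number theorem in \<open>y = x ^ m\<close>: for base
  \<open>y ^ 3\<close> and argument \<open>- (y ^ 2)\<close> the residues 0, 2, 1 modulo 3 exhaust
  all exponents.\<close>

lemma theta_eq_euler_prod_multiples:
  assumes "m > 0"
  shows "theta (x ^ (3 * m)) (- (x ^ (2 * m))) = euler_prod {k. k mod m = 0} x"
proof -
  have y: "0 < x ^ m" "x ^ m < 1"
    using x power_less_one[OF assms] by auto
  have "theta ((x ^ m) ^ 3) (- ((x ^ m)\<^sup>2)) = euler_prod {k. k mod 3 \<in> {0, 1, 2}} (x ^ m)"
    using theta_euler_prod[OF y, of 2 3] y
    by (subst euler_prod_residues) auto
  also have "{k. k mod 3 \<in> {0, 1, 2 :: nat}} = UNIV"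
    by auto
  also have "euler_prod UNIV (x ^ m) = euler_prod (range ((*) m)) x"
    using x assms by (intro euler_prod_power) auto
  also have "range ((*) m) = {k. k mod m = 0}"
    by (auto simp: mod_eq_0_iff_dvd)
  finally show ?thesis
    by (simp add: mult.commute flip: power_mult)
qed

text \<open>In the quintuple product at \<open>q = x ^ m\<close>, \<open>z = x ^ a\<close>, the
  second theta factor on the left contributes the multiples of \<open>2 * m\<close>. By the
  pentagonal number theorem these are also the theta factor on the right, and they cancel.\<close>

lemma euler_prod_quintuple:
  assumes "0 < a" "2 * a < m"
  shows "euler_prod {k. k mod m = 0} x * euler_prod {k. k mod m = a} x * euler_prod {k. k mod m = m - a} x *
     (euler_prod {k. k mod (2 * m) = m + 2 * a} x * euler_prod {k. k mod (2 * m) = m - 2 * a} x)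
    = theta (x ^ (3 * m)) (x ^ (3 * a + m)) - x ^ a * theta (x ^ (3 * m)) (x ^ (3 * a + 2 * m))"
proof -
  have z: "euler_prod {k. k mod (2 * m) = 0} x > 0"
    using x by (intro euler_prod_pos) auto
  have "theta (x ^ (6 * m)) (- (x ^ (4 * m))) = euler_prod {k. k mod (2 * m) = 0} x"
    using theta_eq_euler_prod_multiples[of "2 * m"] assms by simp
  moreover have "theta (x ^ m) (- (x ^ a)) * theta ((x ^ m)\<^sup>2) (- ((x ^ a)\<^sup>2 * x ^ m)) =
    theta ((x ^ m) ^ 6) (- ((x ^ m) ^ 4)) * (theta ((x ^ m) ^ 3) ((x ^ a) ^ 3 * x ^ m) - x ^ a * theta ((x ^ m) ^ 3) ((x ^ a) ^ 3 * (x ^ m)\<^sup>2))"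
    by (rule quintuple_product) (use x power_less_one[of m] assms in auto)
  moreover have "(x ^ m)\<^sup>2 = x ^ (2 * m)" "(x ^ a)\<^sup>2 * x ^ m = x ^ (m + 2 * a)"
    "(x ^ m) ^ 6 = x ^ (6 * m)" "(x ^ m) ^ 4 = x ^ (4 * m)" "(x ^ m) ^ 3 = x ^ (3 * m)"
    "(x ^ a) ^ 3 * x ^ m = x ^ (3 * a + m)" "(x ^ a) ^ 3 * x ^ (2 * m) = x ^ (3 * a + 2 * m)"
    by (simp_all add: mult.commute add.commute flip: power_mult power_add)
  moreover have "2 * m - (m + 2 * a) = m - 2 * a" using assms by simp
  ultimately show ?thesis
    using z theta_euler_prod[OF x, of a m] theta_euler_prod[OF x, of "m + 2 * a" "2 * m"] assms by simp
qed

lemma euler_prod_residues_split: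
  "euler_prod {k. k mod m = r} x = euler_prod {k. k mod (2 * m) = r} x * euler_prod {k. k mod (2 * m) = r + m} x"
  if "r < m" for m r
proof -
  have "k mod m = r \<longleftrightarrow> k mod (2 * m) \<in> {r, r + m}" for k
  proof -
    define a where "a = k mod (2 * m)"
    have a: "a < 2 * m" "k mod m = a mod m"
      using that by (simp_all add: a_def mod_mod_cancel)
    have "a mod m = (if a < m then a else a - m)"
      using a(1) by (simp add: le_mod_geq)
    then show ?thesis
      unfolding a(2) a_def[symmetric] using that a(1) by auto
  qed
  then have "euler_prod {k. k mod m = r} x = euler_prod {k. k mod (2 * m) \<in> {r, r + m}} x" by simp
  also have "\<dots> = euler_prod {k. k mod (2 * m) = r} x * euler_prod {k. k mod (2 * m) = r + m} x"
    using x that by (subst euler_prod_residues) auto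
  finally show ?thesis .
qed

text \<open>Here \<open>m = 24\<close> and \<open>a = 2\<close>: the residues 0, 2, 22 modulo 24
  become 0, 24, 2, 26, 22, 46 modulo 48, and \<open>m + 2 * a\<close>, \<open>m - 2 * a\<close> add
  28 and 20.\<close>

lemma euler_prod_c:
  "euler_prod {k. k mod 48 \<in> {0, 2, 46, 20, 28, 22, 26, 24}} x
    = theta (x ^ 72) (x ^ 30) - x\<^sup>2 * theta (x ^ 72) (x ^ 54)"
  using euler_prod_quintuple[of 2 24] x
    euler_prod_residues_split[of 0 24] euler_prod_residues_split[of 2 24] euler_prod_residues_split[of 22 24]
  by (subst euler_prod_residues) (auto simp: mult_ac)

text \<open>Now \<open>a = 10\<close>: the residues 0, 10, 14 modulo 24 become 0, 24, 10, 34, 14, 38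
  modulo 48, together with 44 and 4.\<close>

lemma euler_prod_d:
  "euler_prod {k. k mod 48 \<in> {0, 4, 44, 10, 38, 14, 34, 24}} x
    = theta (x ^ 72) (x ^ 54) - x ^ 10 * theta (x ^ 72) (x ^ 78)"
  using euler_prod_quintuple[of 10 24] x
    euler_prod_residues_split[of 0 24] euler_prod_residues_split[of 10 24] euler_prod_residues_split[of 14 24]
  by (subst euler_prod_residues) (auto simp: mult_ac)

text \<open>The pentagonal series in \<open>x ^ 6\<close> has base \<open>x ^ 18\<close>. It is
  split by the parity of the index, and reflection turns the argument exponent 42 into 30.\<close>

lemma euler_prod_multiples_6:
  "euler_prod {k. k mod 6 = 0} x = theta (x ^ 72) (x ^ 30) - x ^ 12 * theta (x ^ 72) (x ^ 78)"
proof -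
  have "theta (x ^ 18) (- (x ^ 12)) = theta ((x ^ 18) ^ 4) ((- (x ^ 12))\<^sup>2 * x ^ 18) +
      - (x ^ 12) * theta ((x ^ 18) ^ 4) ((- (x ^ 12))\<^sup>2 * (x ^ 18) ^ 3)"
    by (rule theta_even_odd) (use x power_less_one[of 18] in auto)
  then have "theta (x ^ 18) (- (x ^ 12)) = theta (x ^ 72) (x ^ 42) - x ^ 12 * theta (x ^ 72) (x ^ 78)"
    by (simp flip: power_mult power_add)
  moreover have "theta (x ^ 72) (x ^ 42) = theta (x ^ 72) (x ^ 72 / x ^ 42)"
    by (rule theta_reflect) (use x in auto)
  moreover have "x ^ 72 / x ^ 42 = x ^ 30"
    using x by (simp flip: power_diff)
  ultimately show ?thesis
    using theta_eq_euler_prod_multiples[of 6] by simp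
qed

text \<open>The cube root limit at \<open>y = x ^ 2\<close>, split by parity. After reflection its
  first series is that for the multiples of 6 with the argument negated, so only the odd half
  changes sign.\<close>

lemma prod_tendsto_theta_difference:
  "(\<lambda>n. \<Prod>i<n. (1 - x ^ (2 * i + 2)) * (1 - x ^ (2 * i + 2) + x ^ (4 * i + 4)))
    \<longlonglongrightarrow> theta (x ^ 72) (x ^ 30) + x ^ 12 * theta (x ^ 72) (x ^ 78) - 2 * x\<^sup>2 * theta (x ^ 72) (x ^ 54)"
proof -
  have "0 < x\<^sup>2" "x\<^sup>2 < 1" using x power_less_one[of 2] by auto
  moreover have pw: "(x\<^sup>2) ^ Suc i = x ^ (2 * i + 2)" "(x ^ (2 * i + 2))\<^sup>2 = x ^ (4 * i + 4)"
    "(x\<^sup>2) ^ 3 = x ^ 6" "(x\<^sup>2) ^ 9 = x ^ 18" for i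
    unfolding power_mult[symmetric] by (rule arg_cong[where f = "(^) x"], simp)+
  moreover note prod_tendsto_theta_cube_root[of "x\<^sup>2"]
  ultimately
  have "(\<lambda>n. \<Prod>i<n. (1 - x ^ (2 * i + 2)) * (1 - x ^ (2 * i + 2) + x ^ (4 * i + 4)))
    \<longlonglongrightarrow> theta (x ^ 18) (x ^ 6) - x\<^sup>2 * theta (x ^ 18) (x ^ 18)"
    by (simp only: pw)
  moreover have nz: "x ^ k \<noteq> 0" for k using x by simp
  have "theta (x ^ 18) (x ^ 6) = theta (x ^ 18) (x ^ 18 / x ^ 6)"
    by (rule theta_reflect[OF nz nz])
  moreover have "x ^ 18 / x ^ 6 = x ^ 12"
    using x by (simp flip: power_diff)
  moreover have "theta (x ^ 18) (x ^ 12) = theta ((x ^ 18) ^ 4) ((x ^ 12)\<^sup>2 * x ^ 18) +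
      (x ^ 12) * theta ((x ^ 18) ^ 4) ((x ^ 12)\<^sup>2 * (x ^ 18) ^ 3)"
    by (rule theta_even_odd) (use x power_less_one[of 18] in auto)
  then have "theta (x ^ 18) (x ^ 12) = theta (x ^ 72) (x ^ 42) + x ^ 12 * theta (x ^ 72) (x ^ 78)"
    by (simp flip: power_mult power_add)
  moreover have "theta (x ^ 72) (x ^ 42) = theta (x ^ 72) (x ^ 72 / x ^ 42)"
    by (rule theta_reflect[OF nz nz])
  moreover have "x ^ 72 / x ^ 42 = x ^ 30"
    using x by (simp flip: power_diff)
  moreover have "theta (x ^ 18) (x ^ 18) = theta ((x ^ 18) ^ 4) ((x ^ 18)\<^sup>2 * x ^ 18) +
      (x ^ 18) * theta ((x ^ 18) ^ 4) ((x ^ 18)\<^sup>2 * (x ^ 18) ^ 3)"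
    by (rule theta_even_odd) (use x power_less_one[of 18] in auto)
  then have "theta (x ^ 18) (x ^ 18) = theta (x ^ 72) (x ^ 54) + x ^ 18 * theta (x ^ 72) (x ^ 90)"
    by (simp flip: power_mult power_add)
  \<comment> \<open>Even and odd half of the second series coincide: a shift takes the exponent 90
    to 18 and a reflection takes 18 to 54. Hence the coefficient 2.\<close>
  moreover have "theta (x ^ 72) (x ^ 18) = x ^ 18 * theta (x ^ 72) (x ^ 18 * x ^ 72)"
    by (rule theta_shift[OF nz nz])
  then have "x ^ 18 * theta (x ^ 72) (x ^ 90) = theta (x ^ 72) (x ^ 18)"
    by (simp flip: power_add)
  moreover have "theta (x ^ 72) (x ^ 18) = theta (x ^ 72) (x ^ 72 / x ^ 18)"
    by (rule theta_reflect[OF nz nz])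
  moreover have "x ^ 72 / x ^ 18 = x ^ 54"
    using x by (simp flip: power_diff)
  ultimately show ?thesis
    by (simp add: algebra_simps)
qed

text \<open>For \<open>t = x ^ (2 * i + 2)\<close>, \<open>1 - t + t ^ 2\<close> is
  \<open>(1 + t ^ 3) / (1 + t)\<close>, so the limit just found is a quotient of products over the
  multiples of 2, 4, 6 and 12.\<close>

lemma euler_prod_Q2:
  "euler_prod {k. k mod 12 \<in> {0, 2, 6, 10}} x * euler_prod {k. k mod 6 \<in> {2, 4}} x
    = theta (x ^ 72) (x ^ 30) + x ^ 12 * theta (x ^ 72) (x ^ 78) - 2 * x\<^sup>2 * theta (x ^ 72) (x ^ 54)"
    (is "_ = ?G")
proof -
  define p where "p m = euler_prod {k. k mod m = 0} x" for m
  have p_lim: "(\<lambda>n. \<Prod>i<n. 1 - x ^ (m * i + m)) \<longlonglongrightarrow> p m" if "m > 0" for m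
    using euler_prod_progression[of x m m] x that by (simp add: p_def)
  have p_pos: "p m > 0" for m
    unfolding p_def using x by (intro euler_prod_pos) auto
  have e: "(1 - x ^ (2 * i + 2)) * (1 - x ^ (2 * i + 2) + x ^ (4 * i + 4)) * (1 - x ^ (4 * i + 4)) * (1 - x ^ (6 * i + 6))
    = (1 - x ^ (2 * i + 2)) * (1 - x ^ (2 * i + 2)) * (1 - x ^ (12 * i + 12))" for i
  proof -
    define t where "t = x ^ (2 * i + 2)"
    have t: "x ^ (4 * i + 4) = t\<^sup>2" "x ^ (6 * i + 6) = t ^ 3" "x ^ (12 * i + 12) = t ^ 6"
      unfolding t_def power_mult[symmetric] by (rule arg_cong[where f = "(^) x"], simp)+
    show ?thesis
      unfolding t t_def[symmetric] by (simp add: power2_eq_square power3_eq_cube eval_nat_numeral algebra_simps)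
  qed
  have "(\<lambda>n. (\<Prod>i<n. (1 - x ^ (2 * i + 2)) * (1 - x ^ (2 * i + 2) + x ^ (4 * i + 4))) *
      (\<Prod>i<n. 1 - x ^ (4 * i + 4)) * (\<Prod>i<n. 1 - x ^ (6 * i + 6))) \<longlonglongrightarrow> ?G * p 4 * p 6"
    by (intro tendsto_mult prod_tendsto_theta_difference p_lim) auto
  moreover have "(\<lambda>n. (\<Prod>i<n. 1 - x ^ (2 * i + 2)) * (\<Prod>i<n. 1 - x ^ (2 * i + 2)) * (\<Prod>i<n. 1 - x ^ (12 * i + 12)))
      \<longlonglongrightarrow> p 2 * p 2 * p 12"
    by (intro tendsto_mult p_lim) auto
  ultimately have G: "?G * p 4 * p 6 = p 2 * p 2 * p 12"
    unfolding prod.distrib[symmetric] e by (rule LIMSEQ_unique)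
  have un: "euler_prod {k. P k} x = euler_prod {k. Q k} x * euler_prod {k. R k} x"
    if "\<And>k. P k \<longleftrightarrow> Q k \<or> R k" "\<And>k. \<not> (Q k \<and> R k)" for P Q R :: "nat \<Rightarrow> bool"
  proof -
    have "{k. P k} = {k. Q k} \<union> {k. R k}" "{k. Q k} \<inter> {k. R k} = {}" using that by auto
    then show ?thesis using x by (simp add: euler_prod_Un)
  qed
  \<comment> \<open>One copy of \<open>p 2\<close> is freed of \<open>p 6\<close>; the other one,
    times \<open>p 12\<close>, becomes \<open>p 4\<close> times the residues 0, 2, 6, 10 modulo
    12.\<close>
  have 1: "p 2 = euler_prod {k. k mod 6 \<in> {2, 4}} x * p 6"
    unfolding p_def by (rule un; simp; presburger)
  have 2: "p 2 = euler_prod {k. k mod 12 \<in> {0, 2, 6, 10}} x * euler_prod {k. k mod 12 \<in> {4, 8}} x"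
    unfolding p_def by (rule un; simp; presburger)
  have 4: "p 4 = euler_prod {k. k mod 12 \<in> {4, 8}} x * p 12"
    unfolding p_def by (rule un; simp; presburger)
  have "?G * p 4 * p 6 = p 2 * p 2 * p 12" by (rule G)
  also have "\<dots> = euler_prod {k. k mod 12 \<in> {0, 2, 6, 10}} x * euler_prod {k. k mod 6 \<in> {2, 4}} x * p 4 * p 6"
    by (subst 1, subst 2, subst 4) (simp only: mult_ac)
  finally have "?G * (p 4 * p 6) =
      euler_prod {k. k mod 12 \<in> {0, 2, 6, 10}} x * euler_prod {k. k mod 6 \<in> {2, 4}} x * (p 4 * p 6)"
    by (simp only: mult.assoc)
  moreover have "p 4 * p 6 \<noteq> 0"
    using p_pos[of 4] p_pos[of 6] by simp
  ultimately show ?thesis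
    by (metis mult_right_cancel)
qed

end

section \<open>Generating functions of partitions\<close>

text \<open>Only positive \<open>x\<close> are available. Once the lower coefficients vanish,
  division by \<open>x ^ n\<close> makes \<open>a n\<close> the limit at 0 from the right.\<close>

lemma powser_eq_0_imp_coeff_eq_0:
  fixes a :: "nat \<Rightarrow> real"
  assumes "\<And>x. 0 < x \<Longrightarrow> x < 1 \<Longrightarrow> (\<lambda>n. a n * x ^ n) sums 0"
  shows "a n = 0"
proof (induction n rule: less_induct)
  case (less n)
  have "(\<lambda>i. a (i + n) * x ^ i) sums 0" if x: "0 < x" "x < 1" for x
  proof -
    have "(\<lambda>i. a (i + n) * x ^ (i + n)) sums 0"
      using assms[OF x] less by (subst sums_iff_shift) simp
    from sums_divide[OF this, of "x ^ n"] show ?thesis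
      using x by (simp add: power_add)
  qed
  note shifted = this
  define g where "g x = (\<Sum>i. a (i + n) * x ^ i)" for x
  have sm: "summable (\<lambda>i. a (i + n) * x ^ i)" if "norm x < 1 / 2" for x
    by (rule powser_inside[OF sums_summable[OF shifted[of "1 / 2"]]]) (use that in auto)
  have "(g \<longlongrightarrow> a (0 + n)) (at 0)"
    by (rule powser_limit_0[of "1 / 2" "\<lambda>i. a (i + n)"]) (auto simp: g_def intro!: summable_sums sm)
  then have "(g \<longlongrightarrow> a n) (at_right 0)"
    by (simp add: filterlim_at_split)
  moreover have "\<forall>\<^sub>F x in at_right 0. g x = 0"
    by (rule eventually_at_rightI[of 0 1]) (use shifted in \<open>auto simp: g_def sums_iff\<close>)
  then have "(g \<longlongrightarrow> 0) (at_right 0)"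
    by (rule tendsto_eventually)
  ultimately show "a n = 0"
    using tendsto_unique trivial_limit_at_right_real by blast
qed

text \<open>\<open>J\<close> is the set of admissible multiplicities: \<open>UNIV\<close> for ordinary partitions,
  \<open>{0, 1}\<close> for partitions into distinct parts.\<close>
definition multisets_over :: "'a set \<Rightarrow> nat set \<Rightarrow> 'a multiset set" where
  "multisets_over S J = {M. set_mset M \<subseteq> S \<and> (\<forall>k. count M k \<in> J)}"

lemma multisets_over_mono: "S \<subseteq> T \<Longrightarrow> multisets_over S J \<subseteq> multisets_over T J"
  by (auto simp: multisets_over_def)

text \<open>The multiplicity of \<open>a\<close> and the rest of the multiset are independent
  choices; \<open>0 \<in> J\<close> keeps the rest, where \<open>a\<close> has multiplicity 0,
  admissible.\<close>

lemma bij_betw_multisets_over_insert: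
  assumes "a \<notin> S" "0 \<in> J"
  shows "bij_betw (\<lambda>(j, M). replicate_mset j a + M) (J \<times> multisets_over S J) (multisets_over (insert a S) J)"
proof (rule bij_betwI[where g = "\<lambda>M. (count M a, filter_mset (\<lambda>k. k \<noteq> a) M)"])
  have c: "count M a = 0" if "M \<in> multisets_over S J" for M
    using that assms by (auto simp: multisets_over_def count_eq_zero_iff)
  show "(\<lambda>(j, M). replicate_mset j a + M) \<in> J \<times> multisets_over S J \<rightarrow> multisets_over (insert a S) J"
    using c by (auto simp: multisets_over_def dest: subsetD split: if_splits)
  show "(\<lambda>M. (count M a, filter_mset (\<lambda>k. k \<noteq> a) M)) \<in> multisets_over (insert a S) J \<rightarrow> J \<times> multisets_over S J"
    using assms by (auto simp: multisets_over_def)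
  show "(count (case p of (j, M) \<Rightarrow> replicate_mset j a + M) a,
      filter_mset (\<lambda>k. k \<noteq> a) (case p of (j, M) \<Rightarrow> replicate_mset j a + M)) = p"
    if "p \<in> J \<times> multisets_over S J" for p
    using that c by (auto intro!: multiset_eqI)
  show "(case (count M a, filter_mset (\<lambda>k. k \<noteq> a) M) of (j, M) \<Rightarrow> replicate_mset j a + M) = M" for M
    by (auto intro!: multiset_eqI)
qed

text \<open>\<open>\<phi>\<close> is the generating function of one multiplicity; each new part
  contributes an independent factor.\<close>

lemma has_sum_multisets_over_finite:
  fixes x :: real
  assumes S: "finite S" "S \<subseteq> {0<..}" and J: "0 \<in> J" and x: "0 \<le> x" "x < 1"
    and \<phi>: "\<And>t. 0 \<le> t \<Longrightarrow> t < 1 \<Longrightarrow> ((\<lambda>j. t ^ j) has_sum \<phi> t) J"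
  shows "((\<lambda>M. x ^ \<Sum>\<^sub># M) has_sum (\<Prod>k\<in>S. \<phi> (x ^ k))) (multisets_over S J)"
  using S
proof induction
  case empty
  have "multisets_over ({} :: nat set) J = {{#}}"
    using J by (auto simp: multisets_over_def)
  then show ?case by (intro has_sum_finiteI) simp_all
next
  case (insert a S)
  then have IH: "((\<lambda>M. x ^ \<Sum>\<^sub># M) has_sum (\<Prod>k\<in>S. \<phi> (x ^ k))) (multisets_over S J)" by simp
  have "x ^ a < 1"
    using insert x by (auto simp: power_less_one_iff)
  then have a: "((\<lambda>j. (x ^ a) ^ j) has_sum \<phi> (x ^ a)) J"
    using x by (intro \<phi>) auto
  have "((\<lambda>(j, M). (x ^ a) ^ j * x ^ \<Sum>\<^sub># M) has_sum (\<phi> (x ^ a) * (\<Prod>k\<in>S. \<phi> (x ^ k)))) (J \<times> multisets_over S J)"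
    by (intro has_sum_product a IH summable_on_iff_abs_summable_on_real[THEN iffD1]
        has_sum_imp_summable[OF a] has_sum_imp_summable[OF IH])
  also have "(\<lambda>(j, M). (x ^ a) ^ j * x ^ \<Sum>\<^sub># M) = (\<lambda>p. x ^ \<Sum>\<^sub># (case p of (j, M) \<Rightarrow> replicate_mset j a + M))"
    by (auto simp: power_add sum_mset_replicate_mset mult.commute simp flip: power_mult)
  finally show ?case
    using has_sum_reindex_bij_betw[OF bij_betw_multisets_over_insert, of a S J "\<lambda>M. x ^ \<Sum>\<^sub># M"] insert J
    by simp
qed

text \<open>All terms are nonnegative, so monotone approximation by bounded part sizes
  suffices.\<close>

lemma has_sum_multisets_over:
  fixes x :: real
  assumes S: "S \<subseteq> {0<..}" and J: "0 \<in> J" and x: "0 \<le> x" "x < 1"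
    and \<phi>: "\<And>t. 0 \<le> t \<Longrightarrow> t < 1 \<Longrightarrow> ((\<lambda>j. t ^ j) has_sum \<phi> t) J"
    and lim: "(\<lambda>n. \<Prod>k\<in>S \<inter> {0<..n}. \<phi> (x ^ k)) \<longlonglongrightarrow> L"
  shows "((\<lambda>M. x ^ \<Sum>\<^sub># M) has_sum L) (multisets_over S J)"
proof -
  define P where "P n = (\<Prod>k\<in>S \<inter> {0<..n}. \<phi> (x ^ k))" for n
  have P: "((\<lambda>M. x ^ \<Sum>\<^sub># M) has_sum P n) (multisets_over (S \<inter> {0<..n}) J)" for n
    unfolding P_def by (rule has_sum_multisets_over_finite) (use J x \<phi> in auto)
  have "incseq P"
  proof (rule incseq_SucI)
    fix n
    show "P n \<le> P (Suc n)"
      by (rule has_sum_mono2[OF P P multisets_over_mono]) (use x in auto)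
  qed
  then have P_le: "P n \<le> L" for n
    using lim incseq_le unfolding P_def by blast
  \<comment> \<open>Finitely many multisets have a common bound on their parts, so a finite partial
    sum is already below some \<open>P n\<close>.\<close>
  have finite_le: "(\<Sum>M\<in>F. x ^ \<Sum>\<^sub># M) \<le> L" if F: "finite F" "F \<subseteq> multisets_over S J" for F
  proof -
    obtain n where n: "\<And>k. k \<in> (\<Union>M\<in>F. set_mset M) \<Longrightarrow> k \<le> n"
      using F(1) by (metis finite_UN finite_set_mset finite_nat_set_iff_bounded_le)
    have "F \<subseteq> multisets_over (S \<inter> {0<..n}) J"
      using F(2) S n by (fastforce simp: multisets_over_def)
    then have "(\<Sum>M\<in>F. x ^ \<Sum>\<^sub># M) \<le> P n"
      using F(1) x by (intro finite_sum_le_has_sum[OF P]) auto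
    then show ?thesis using P_le[of n] by simp
  qed
  have summable: "(\<lambda>M. x ^ \<Sum>\<^sub># M) summable_on multisets_over S J"
  proof (rule nonneg_bdd_above_summable_on)
    show "bdd_above (sum (\<lambda>M. x ^ \<Sum>\<^sub># M) ` {F. F \<subseteq> multisets_over S J \<and> finite F})"
      using finite_le by (intro bdd_aboveI[of _ L]) blast
  qed (use x in simp)
  have "P n \<le> infsum (\<lambda>M. x ^ \<Sum>\<^sub># M) (multisets_over S J)" for n
    by (rule has_sum_mono2[OF P has_sum_infsum[OF summable] multisets_over_mono]) (use x in auto)
  then have "L \<le> infsum (\<lambda>M. x ^ \<Sum>\<^sub># M) (multisets_over S J)"
    using lim by (intro LIMSEQ_le_const2[of P]) (auto simp: P_def[abs_def])
  moreover have "infsum (\<lambda>M. x ^ \<Sum>\<^sub># M) (multisets_over S J) \<le> L"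
    using summable finite_le by (rule infsum_le_finite_sums)
  ultimately show ?thesis
    using has_sum_infsum[OF summable] by simp
qed

lemma sums_card_multisets_over:
  fixes x :: real
  assumes S: "S \<subseteq> {0<..}" and J: "0 \<in> J" and x: "0 \<le> x" "x < 1"
    and \<phi>: "\<And>t. 0 \<le> t \<Longrightarrow> t < 1 \<Longrightarrow> ((\<lambda>j. t ^ j) has_sum \<phi> t) J"
    and lim: "(\<lambda>n. \<Prod>k\<in>S \<inter> {0<..n}. \<phi> (x ^ k)) \<longlonglongrightarrow> L"
    and fin: "\<And>n. finite {M \<in> multisets_over S J. \<Sum>\<^sub># M = n}"
  shows "(\<lambda>n. real (card {M \<in> multisets_over S J. \<Sum>\<^sub># M = n}) * x ^ n) sums L"
proof (rule has_sum_imp_sums, rule has_sum_SigmaD)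
  have "bij_betw snd (SIGMA n:UNIV. {M \<in> multisets_over S J. \<Sum>\<^sub># M = n}) (multisets_over S J)"
    by (auto simp: bij_betw_def inj_on_def image_iff)
  then show "((\<lambda>p. x ^ \<Sum>\<^sub># (snd p)) has_sum L) (SIGMA n:UNIV. {M \<in> multisets_over S J. \<Sum>\<^sub># M = n})"
    using has_sum_multisets_over[OF S J x \<phi> lim] has_sum_reindex_bij_betw[of snd _ _ "\<lambda>M. x ^ \<Sum>\<^sub># M"] by blast
  show "((\<lambda>M. x ^ \<Sum>\<^sub># (snd (n, M))) has_sum real (card {M \<in> multisets_over S J. \<Sum>\<^sub># M = n}) * x ^ n)
      {M \<in> multisets_over S J. \<Sum>\<^sub># M = n}" for n
    by (rule has_sum_finiteI[OF fin]) simp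
qed

text \<open>Euler's product over \<open>S\<close> is written through its complement to give all
  generating functions the same denominator.\<close>

lemma sums_partitions:
  fixes x :: real
  assumes S: "S \<subseteq> {0<..}" and x: "0 < x" "x < 1"
  shows "(\<lambda>n. real (card {M \<in> partitions n. set_mset M \<subseteq> S}) * x ^ n) sums
    (euler_prod (- S) x / euler_prod UNIV x)"
proof -
  have pos: "euler_prod T x > 0" for T
    using x by (intro euler_prod_pos) auto
  have eq: "{M \<in> multisets_over S UNIV. \<Sum>\<^sub># M = n} = {M \<in> partitions n. set_mset M \<subseteq> S}" for n
    using S by (auto simp: multisets_over_def partitions_def)
  have "(\<lambda>n. inverse (\<Prod>k\<in>S \<inter> {0<..n}. 1 - x ^ k)) \<longlonglongrightarrow> inverse (euler_prod S x)"
    using x pos[of S] by (intro tendsto_inverse euler_prod_tendsto) auto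
  then have lim: "(\<lambda>n. \<Prod>k\<in>S \<inter> {0<..n}. inverse (1 - x ^ k)) \<longlonglongrightarrow> inverse (euler_prod S x)"
    by (simp add: prod_inversef[symmetric] o_def)
  have geo: "((\<lambda>j. t ^ j) has_sum inverse (1 - t)) UNIV" if "0 \<le> t" "t < 1" for t :: real
    using geometric_sums[of t] that by (intro norm_summable_imp_has_sum) (auto simp: summable_geometric divide_inverse)
  have "(\<lambda>n. real (card {M \<in> multisets_over S UNIV. \<Sum>\<^sub># M = n}) * x ^ n) sums inverse (euler_prod S x)"
    by (rule sums_card_multisets_over[OF S _ _ x(2) geo lim]) (use x finite_partitions in \<open>auto simp: eq\<close>)
  moreover have "euler_prod UNIV x = euler_prod S x * euler_prod (- S) x"
    using euler_prod_Un[of x S "- S"] x by simp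
  ultimately show ?thesis
    using pos[of S] pos[of "- S"] by (simp add: eq field_simps)
qed

text \<open>Euler's device \<open>1 + x ^ k = (1 - x ^ (2 * k)) / (1 - x ^ k)\<close> turns distinct
  parts into a quotient of two products, the numerator running over the doubled parts.\<close>

lemma sums_distinct_partitions:
  fixes x :: real
  assumes S: "S \<subseteq> {0<..}" and x: "0 < x" "x < 1"
  shows "(\<lambda>n. real (card {M \<in> partitions n. set_mset M \<subseteq> S \<and> (\<forall>k\<in>#M. count M k = 1)}) * x ^ n) sums
    (euler_prod ((*) 2 ` S) x * euler_prod (- S) x / euler_prod UNIV x)"
proof -
  have pos: "euler_prod T x > 0" for T
    using x by (intro euler_prod_pos) auto
  have "(\<forall>k. count M k \<in> {0, 1}) \<longleftrightarrow> (\<forall>k\<in>#M. count M k = 1)" for M :: "nat multiset"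
    by (metis count_eq_zero_iff insert_iff singletonD)
  then have eq: "{M \<in> multisets_over S {0, 1}. \<Sum>\<^sub># M = n} =
      {M \<in> partitions n. set_mset M \<subseteq> S \<and> (\<forall>k\<in>#M. count M k = 1)}" for n
    using S unfolding multisets_over_def partitions_def by auto
  have fin: "finite {M \<in> multisets_over S {0, 1}. \<Sum>\<^sub># M = n}" for n
    unfolding eq using finite_partitions by simp
  have lt1: "x ^ k < 1" if "k > 0" for k
    using that x by (simp add: power_less_one_iff)
  have "(\<lambda>n. (\<Prod>k\<in>S \<inter> {0<..n}. 1 - (x\<^sup>2) ^ k) / (\<Prod>k\<in>S \<inter> {0<..n}. 1 - x ^ k)) \<longlonglongrightarrow>
      euler_prod S (x\<^sup>2) / euler_prod S x"
    using x pos[of S] lt1[of 2] by (intro tendsto_divide euler_prod_tendsto) auto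
  also have "(\<lambda>n. (\<Prod>k\<in>S \<inter> {0<..n}. 1 - (x\<^sup>2) ^ k) / (\<Prod>k\<in>S \<inter> {0<..n}. 1 - x ^ k)) =
      (\<lambda>n. \<Prod>k\<in>S \<inter> {0<..n}. 1 + x ^ k)"
  proof
    fix n
    have "(1 - (x\<^sup>2) ^ k) / (1 - x ^ k) = 1 + x ^ k" if "k \<in> S \<inter> {0<..n}" for k
    proof -
      have "(x\<^sup>2) ^ k = x ^ k * x ^ k"
        by (simp add: power2_eq_square power_mult_distrib)
      then show ?thesis
        using lt1[of k] that by (simp add: field_simps)
    qed
    then show "(\<Prod>k\<in>S \<inter> {0<..n}. 1 - (x\<^sup>2) ^ k) / (\<Prod>k\<in>S \<inter> {0<..n}. 1 - x ^ k) = (\<Prod>k\<in>S \<inter> {0<..n}. 1 + x ^ k)"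
      unfolding prod_dividef[symmetric] by (intro prod.cong) auto
  qed
  finally have lim: "(\<lambda>n. \<Prod>k\<in>S \<inter> {0<..n}. 1 + x ^ k) \<longlonglongrightarrow> euler_prod S (x\<^sup>2) / euler_prod S x" .
  have two: "((\<lambda>j. t ^ j) has_sum (1 + t)) {0, 1}" for t :: real
    by (rule has_sum_finiteI) auto
  have "(\<lambda>n. real (card {M \<in> multisets_over S {0, 1}. \<Sum>\<^sub># M = n}) * x ^ n) sums (euler_prod S (x\<^sup>2) / euler_prod S x)"
    by (rule sums_card_multisets_over[OF S _ _ x(2) two lim fin]) (use x in auto)
  moreover have "euler_prod UNIV x = euler_prod S x * euler_prod (- S) x"
    using euler_prod_Un[of x S "- S"] x by simp
  moreover have "euler_prod S (x\<^sup>2) = euler_prod ((*) 2 ` S) x"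
    using x by (intro euler_prod_power) auto
  ultimately show ?thesis
    unfolding eq using pos[of S] pos[of "- S"] by simp
qed

section \<open>The generating functions of the four counting functions\<close>

lemma not_cong_iff:
  "(\<forall>r\<in>R. \<not> [int k = r] (mod int m)) \<longleftrightarrow> k mod m \<notin> (\<lambda>r. nat (r mod int m)) ` R" if "m > 0"
  using that by (auto simp: unique_euclidean_semiring_class.cong_def image_iff zmod_int[symmetric])

lemma partitions_avoiding_eq:
  assumes "m > 0"
  shows "partitions_avoiding (int m) R n =
    {M \<in> partitions n. set_mset M \<subseteq> {0<..} - {k. k mod m \<in> (\<lambda>r. nat (r mod int m)) ` R}}"
  using assms by (auto simp: partitions_avoiding_def partitions_def not_cong_iff)

lemma euler_prod_avoiding:
  "euler_prod (- ({0<..} - T)) x = euler_prod T x"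
  by (rule euler_prod_cong) auto

lemma sums_partitions_avoiding:
  fixes x :: real
  assumes "0 < x" "x < 1"
  shows "(\<lambda>n. real (card {M \<in> partitions n. set_mset M \<subseteq> {0<..} - T}) * x ^ n) sums
    (euler_prod T x / euler_prod UNIV x)"
  using sums_partitions[of "{0<..} - T" x] assms unfolding euler_prod_avoiding by blast

lemma generating_functions:
  assumes x: "0 < x" "x < 1"
  defines "f \<equiv> euler_prod UNIV x"
  shows "(\<lambda>n. real (b6 n) * x ^ n) sums (euler_prod {k. k mod 6 = 0} x / f)"
    and "(\<lambda>n. real (Q2 n) * x ^ n) sums
      (euler_prod {k. k mod 12 \<in> {0, 2, 6, 10}} x * euler_prod {k. k mod 6 \<in> {2, 4}} x / f)"
    and "(\<lambda>n. real (c n) * x ^ n) sums (euler_prod {k. k mod 48 \<in> {0, 2, 46, 20, 28, 22, 26, 24}} x / f)"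
    and "(\<lambda>n. real (d (int n)) * x ^ n) sums (euler_prod {k. k mod 48 \<in> {0, 4, 44, 10, 38, 14, 34, 24}} x / f)"
proof -
  have "b6 n = card {M \<in> partitions n. set_mset M \<subseteq> {0<..} - {k. k mod 6 = 0}}" for n
    unfolding b6_def by (rule arg_cong[where f = card]) (auto simp: partitions_def mod_eq_0_iff_dvd)
  then show "(\<lambda>n. real (b6 n) * x ^ n) sums (euler_prod {k. k mod 6 = 0} x / f)"
    using sums_partitions_avoiding[OF x] by (simp only: f_def)
  have "c n = card {M \<in> partitions n. set_mset M \<subseteq> {0<..} - {k. k mod 48 \<in> {0, 2, 46, 20, 28, 22, 26, 24}}}" for n
    unfolding c_def using partitions_avoiding_eq[of 48 "{0, 2, -2, 20, -20, 22, -22, 24}" n] by simp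
  then show "(\<lambda>n. real (c n) * x ^ n) sums (euler_prod {k. k mod 48 \<in> {0, 2, 46, 20, 28, 22, 26, 24}} x / f)"
    using sums_partitions_avoiding[OF x] by (simp only: f_def)
  have "d (int n) = card {M \<in> partitions n. set_mset M \<subseteq> {0<..} - {k. k mod 48 \<in> {0, 4, 44, 10, 38, 14, 34, 24}}}" for n
    unfolding d_def using partitions_avoiding_eq[of 48 "{0, 4, -4, 10, -10, 14, -14, 24}" n] by simp
  then show "(\<lambda>n. real (d (int n)) * x ^ n) sums (euler_prod {k. k mod 48 \<in> {0, 4, 44, 10, 38, 14, 34, 24}} x / f)"
    using sums_partitions_avoiding[OF x] by (simp only: f_def)
  define S where "S = {0<..} - {k. k mod 6 \<in> {2, 4 :: nat}}"
  have "{M \<in> partitions_avoiding 6 {2, -2} n. \<forall>k\<in>#M. count M k = 1}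
      = {M \<in> partitions n. set_mset M \<subseteq> S \<and> (\<forall>k\<in>#M. count M k = 1)}" for n
    using partitions_avoiding_eq[of 6 "{2, -2}" n] by (auto simp: S_def)
  then have "Q2 n = card {M \<in> partitions n. set_mset M \<subseteq> S \<and> (\<forall>k\<in>#M. count M k = 1)}" for n
    by (simp add: Q2_def)
  \<comment> \<open>The members of \<open>S\<close> have residues 0, 1, 3, 5 modulo 6; doubling
    gives 0, 2, 6, 10 modulo 12.\<close>
  moreover have "euler_prod ((*) 2 ` S) x = euler_prod {k. k mod 12 \<in> {0, 2, 6, 10}} x"
  proof (rule euler_prod_cong)
    fix k :: nat assume "k > 0"
    show "k \<in> (*) 2 ` S \<longleftrightarrow> k \<in> {k. k mod 12 \<in> {0, 2, 6, 10}}"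
    proof (cases "even k")
      case True
      then obtain l where l: "k = 2 * l" by blast
      have "k mod 12 = 2 * (l mod 6)"
        unfolding l by (simp add: mult_mod_right)
      moreover have "l mod 6 < 6" by simp
      then have "2 * (l mod 6) \<in> {0, 2, 6, 10} \<longleftrightarrow> l mod 6 \<notin> {2, 4}" by auto
      moreover have "k \<in> (*) 2 ` S \<longleftrightarrow> l mod 6 \<notin> {2, 4}"
        using \<open>k > 0\<close> by (auto simp: l S_def)
      ultimately show ?thesis by simp
    next
      case False
      then have "odd (k mod 12)" by (simp add: dvd_mod_iff)
      then have "k mod 12 \<notin> {0, 2, 6, 10}" by (auto intro!: Nat.gr0I)
      then show ?thesis using False by auto
    qed
  qed
  ultimately show "(\<lambda>n. real (Q2 n) * x ^ n) sums
      (euler_prod {k. k mod 12 \<in> {0, 2, 6, 10}} x * euler_prod {k. k mod 6 \<in> {2, 4}} x / f)"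
    using sums_distinct_partitions[of S x] x euler_prod_avoiding[of "{k. k mod 6 \<in> {2, 4}}" x]
    by (simp add: f_def S_def)
qed

theorem theorem1p5:
  fixes n :: nat
  shows "int (Q2 n) = int (c n) - int (d (int n - 2))
       \<and> int (b6 n) = int (c n) + int (d (int n - 2))"
proof -
  \<comment> \<open>\<open>D\<close> vanishes at 0 and 1 because \<open>d\<close> is 0 at negative
    arguments, so multiplication by \<open>x ^ 2\<close> is a plain index shift.\<close>
  define D where "D n = real (d (int n - 2))" for n
  have *: "(\<lambda>n. (real (Q2 n) - (real (c n) - D n)) * x ^ n) sums 0 \<and>
      (\<lambda>n. (real (b6 n) - (real (c n) + D n)) * x ^ n) sums 0" if x: "0 < x" "x < 1" for x
  proof -
    define f where "f = euler_prod UNIV x"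
    define u v w where "u = theta (x ^ 72) (x ^ 30)" and "v = x\<^sup>2 * theta (x ^ 72) (x ^ 54)"
      and "w = x ^ 12 * theta (x ^ 72) (x ^ 78)"
    note defs = f_def u_def v_def w_def
    have Q: "(\<lambda>n. real (Q2 n) * x ^ n) sums ((u + w - 2 * v) / f)"
      using generating_functions(2)[OF x] by (simp only: euler_prod_Q2[OF x] defs mult.assoc)
    have B: "(\<lambda>n. real (b6 n) * x ^ n) sums ((u - w) / f)"
      using generating_functions(1)[OF x] by (simp only: euler_prod_multiples_6[OF x] defs)
    have C: "(\<lambda>n. real (c n) * x ^ n) sums ((u - v) / f)"
      using generating_functions(3)[OF x] by (simp only: euler_prod_c[OF x] defs)
    have "(\<lambda>n. x\<^sup>2 * (real (d (int n)) * x ^ n)) sums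
        (x\<^sup>2 * ((theta (x ^ 72) (x ^ 54) - x ^ 10 * theta (x ^ 72) (x ^ 78)) / f))"
      using generating_functions(4)[OF x] unfolding euler_prod_d[OF x] f_def by (rule sums_mult)
    also have "x\<^sup>2 * ((theta (x ^ 72) (x ^ 54) - x ^ 10 * theta (x ^ 72) (x ^ 78)) / f) = (v - w) / f"
      by (simp add: v_def w_def right_diff_distrib flip: mult.assoc power_add)
    also have "(\<lambda>n. x\<^sup>2 * (real (d (int n)) * x ^ n)) = (\<lambda>n. D (n + 2) * x ^ (n + 2))"
      by (simp add: D_def power_add power2_eq_square mult_ac)
    finally have "(\<lambda>n. D n * x ^ n) sums ((v - w) / f + (\<Sum>i<2. D i * x ^ i))"
      by (rule sums_iff_shift[of "\<lambda>n. D n * x ^ n" 2, THEN iffD1])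
    moreover have "(\<Sum>i<2. D i * x ^ i) = 0"
      by (simp add: D_def d_def numeral_2_eq_2)
    ultimately have D: "(\<lambda>n. D n * x ^ n) sums ((v - w) / f)" by simp
    \<comment> \<open>Both claims reduce to \<open>u + w - 2 * v = (u - v) - (v - w)\<close> and
      \<open>u - w = (u - v) + (v - w)\<close>.\<close>
    have "(u + w - 2 * v) / f - ((u - v) / f - (v - w) / f) = 0"
      "(u - w) / f - ((u - v) / f + (v - w) / f) = 0"
      by (simp_all flip: diff_divide_distrib add_divide_distrib)
    then show ?thesis
      using sums_diff[OF Q sums_diff[OF C D]] sums_diff[OF B sums_add[OF C D]]
      by (simp add: left_diff_distrib distrib_right)
  qed
  have "real (Q2 n) - (real (c n) - D n) = 0" "real (b6 n) - (real (c n) + D n) = 0"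
    using * by (intro powser_eq_0_imp_coeff_eq_0[where a = "\<lambda>n. real (Q2 n) - (real (c n) - D n)"]
        powser_eq_0_imp_coeff_eq_0[where a = "\<lambda>n. real (b6 n) - (real (c n) + D n)"]; blast)+
  then have "real_of_int (int (Q2 n)) = real_of_int (int (c n) - int (d (int n - 2)))"
    "real_of_int (int (b6 n)) = real_of_int (int (c n) + int (d (int n - 2)))"
    by (simp_all add: D_def)
  then show ?thesis
    by (simp only: of_int_eq_iff)
qed

end
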